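(* For every $\varepsilon>0$ there exists $n_0$ such that for all $n\ge n_0$, every subset $A\subseteq\{1,\dots,n\}$ with no nontrivial solution $(x_1,\dots,x_5)\in A^5$ to the equation $x_1+x_2+2x_3=x_4+3x_5$ satisfies $|A|\le\varepsilon\sqrt n$. Here a solution is trivial if it is of the form $(x_1,\dots,x_5)=(x,y,y,x,y)$ or $(y,x,y,x,y)$ for some $x,y\in\mathbb Z$.
   Context: Equivalently, such a set has size $o(\sqrt n)$. *)

theory Defs
  imports Complex_Main
begin

definition trivial_sol :: "int \<Rightarrow> int \<Rightarrow> int \<Rightarrow> int \<Rightarrow> int \<Rightarrow> bool" where
  "trivial_sol x1 x2 x3 x4 x5 \<longleftrightarrow>
     (\<exists>x y. (x1, x2, x3, x4, x5) = (x, y, y, x, y) \<or> (x1, x2, x3, x4, x5) = (y, x, y, x, y))"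

definition no_nontrivial_sol :: "int set \<Rightarrow> bool" where
  "no_nontrivial_sol A \<longleftrightarrow>
     (\<forall>x1\<in>A. \<forall>x2\<in>A. \<forall>x3\<in>A. \<forall>x4\<in>A. \<forall>x5\<in>A.
        x1 + x2 + 2 * x3 = x4 + 3 * x5 \<longrightarrow> trivial_sol x1 x2 x3 x4 x5)"

end

theory Submission
  imports Defs "HOL-Library.FuncSet"
begin

text \<open>Taking \<open>x\<^sub>3 = x\<^sub>5\<close> shows that \<open>A\<close> is a Sidon set. Embed \<open>A\<close> in the residues modulo
  \<open>N = 6n + 1\<close> and let \<open>S\<close> be the Fourier transform of its indicator function; since \<open>A\<close> is Sidon,
  the fourth moment of \<open>S / sqrt N\<close> is bounded. Suppose that \<open>A\<close> has at least \<open>\<alpha> sqrt N\<close> elements.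
  Averaging \<open>sqrt N 1\<^sub>A\<close> over a Bohr set \<open>B\<close> on which all large frequencies of \<open>A\<close> are almost
  trivial gives a function \<open>h\<close> with mean at least \<open>\<alpha>\<close>. The differences of a Sidon set are distinct,
  so \<open>h\<close> has bounded second moment, and hence \<open>min h 1\<close> still has mean at least \<open>\<alpha>\<^sup>2 / 2\<close>.
  The equation has five variables, so the fourth moment bound shows that \<open>h\<close> and \<open>sqrt N 1\<^sub>A\<close> have
  nearly the same weighted number of solutions.

  Run this along a rapidly decreasing sequence of thresholds for the large frequencies. The
  frequencies gained between two steps carry total mass bounded independently of \<open>N\<close>, so at some
  step this mass is negligible and \<open>h\<close> is almost invariant under translation by the previous Bohr set
  \<open>D\<close>. The solutions \<open>(x, y, y + b, x + 2b - 3c, y + c)\<close> with \<open>b, c \<in> D\<close> then contribute a positive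
  proportion of \<open>N\<^sup>4\<close>, whereas the trivial solutions of \<open>A\<close> contribute only \<open>O(N\<^sup>7\<^sup>/\<^sup>2)\<close>.\<close>

section \<open>Fourier analysis modulo \<open>N\<close>\<close>

locale residue_fourier =
  fixes N :: nat
  assumes N_pos: "N > 0"
begin

definition Z :: "int set" where "Z = {0..<int N}"

definition e :: "int \<Rightarrow> complex" where "e k = cis (2 * pi * real_of_int k / real N)"

text \<open>Functions on the residues are modelled as functions on all of \<open>int\<close> with
  period \<open>N\<close>, so that shifts and dilations of the argument need no reduction; only sums
  are restricted to the representatives in \<open>Z\<close>.\<close>

definition periodic :: "(int \<Rightarrow> 'a) \<Rightarrow> bool" where
  "periodic g \<longleftrightarrow> (\<forall>x. g (x mod int N) = g x)"

definition dft :: "(int \<Rightarrow> real) \<Rightarrow> int \<Rightarrow> complex" where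
  "dft g r = (\<Sum>x\<in>Z. of_real (g x) * e (r * x))"

definition ind :: "int set \<Rightarrow> int \<Rightarrow> real" where
  "ind B x = (if x mod int N \<in> B then 1 else 0)"

definition conv :: "(int \<Rightarrow> real) \<Rightarrow> (int \<Rightarrow> real) \<Rightarrow> int \<Rightarrow> real" where
  "conv g k x = (\<Sum>y\<in>Z. g y * k (x - y))"

lemma finite_Z [simp]: "finite Z" and card_Z [simp]: "card Z = N"
  by (simp_all add: Z_def)

lemma mod_in_Z [simp]: "x mod int N \<in> Z"
  using N_pos by (simp add: Z_def)

lemma mod_Z [simp]: "x \<in> Z \<Longrightarrow> x mod int N = x"
  by (simp add: Z_def)

lemma periodicD: "periodic g \<Longrightarrow> x mod int N = y mod int N \<Longrightarrow> g x = g y"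
  unfolding periodic_def by metis

lemma periodicI: "(\<And>x y. x mod int N = y mod int N \<Longrightarrow> g x = g y) \<Longrightarrow> periodic g"
  unfolding periodic_def by (metis mod_mod_trivial)

lemma e_0 [simp]: "e 0 = 1" by (simp add: e_def)

lemma e_add: "e (j + k) = e j * e k"
  by (simp add: e_def cis_mult add_divide_distrib distrib_left)

lemma e_diff: "e (j - k) = e j * e (- k)"
  using e_add[of j "- k"] by simp

lemma norm_e [simp]: "cmod (e k) = 1" by (simp add: e_def)

lemma cnj_e: "cnj (e k) = e (- k)" by (simp add: e_def cis_cnj)

lemma e_eq_1_iff: "e k = 1 \<longleftrightarrow> int N dvd k"
proof
  assume "e k = 1"
  then have "cos (2 * pi * real_of_int k / real N) = 1"
    by (simp add: e_def complex_eq_iff)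
  then obtain j :: int where "2 * pi * real_of_int k / real N = real_of_int j * 2 * pi"
    by (auto simp: cos_one_2pi_int)
  then have "real_of_int k = real_of_int (j * int N)"
    using N_pos by (simp add: field_simps)
  then have "k = j * int N" by linarith
  then show "int N dvd k" by simp
next
  assume "int N dvd k"
  then obtain j where "k = int N * j" by (elim dvdE)
  then have "2 * pi * real_of_int k / real N = 2 * pi * real_of_int j"
    using N_pos by simp
  then show "e k = 1"
    by (simp add: e_def cis_multiple_2pi)
qed

lemma e_cong: "j mod int N = k mod int N \<Longrightarrow> e j = e k"
proof -
  assume "j mod int N = k mod int N"
  then have "int N dvd j - k" by (simp add: mod_eq_dvd_iff)
  then have "e (j - k) = 1" by (simp add: e_eq_1_iff)
  then show ?thesis using e_add[of "j - k" k] by simp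
qed

lemma periodic_e_mult [simp]: "periodic (\<lambda>x. e (r * x))" "periodic (\<lambda>r. e (r * x))"
  by (auto intro!: periodicI e_cong intro: mod_mult_cong)

lemma periodic_mult: "periodic f \<Longrightarrow> periodic g \<Longrightarrow> periodic (\<lambda>x. f x * g x)"
  by (simp add: periodic_def)

lemma periodic_comp: "periodic g \<Longrightarrow> periodic (\<lambda>x. h (g x))"
  by (simp add: periodic_def)

lemma periodic_sum: "(\<And>y. y \<in> Y \<Longrightarrow> periodic (\<lambda>x. f x y)) \<Longrightarrow> periodic (\<lambda>x. \<Sum>y\<in>Y. f x y)"
  by (simp add: periodic_def)

lemma periodic_affine:
  assumes "periodic g" shows "periodic (\<lambda>x. g (m * x + c))"
proof (rule periodicI)
  fix x y :: int assume "x mod int N = y mod int N"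
  then have "(m * x + c) mod int N = (m * y + c) mod int N"
    by (intro mod_add_cong mod_mult_cong refl)
  then show "g (m * x + c) = g (m * y + c)" by (rule periodicD[OF assms])
qed

lemma periodic_shift: "periodic g \<Longrightarrow> periodic (\<lambda>x. g (x + c))"
  using periodic_affine[of g 1 c] by simp

lemma periodic_shift': "periodic g \<Longrightarrow> periodic (\<lambda>x. g (x - c))"
  using periodic_affine[of g 1 "- c"] by simp

lemma periodic_dft: "periodic (dft g)"
  unfolding dft_def by (intro periodic_sum periodic_mult) (simp_all add: periodic_def)

lemma periodic_ind [simp]: "periodic (ind B)"
  by (simp add: periodic_def ind_def)

text \<open>Reducing \<open>\<phi>\<close> modulo \<open>N\<close> gives an injective self-map of
  the finite set \<open>Z\<close>, hence a permutation, and periodicity of \<open>g\<close> absorbs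
  the reduction. Shifts and dilations by units are the instances needed.\<close>

lemma sum_reindex_periodic:
  assumes "periodic g" "\<And>x y. int N dvd \<phi> x - \<phi> y \<Longrightarrow> int N dvd x - y"
  shows "(\<Sum>x\<in>Z. g (\<phi> x)) = (\<Sum>x\<in>Z. g x)"
proof -
  let ?f = "\<lambda>x. \<phi> x mod int N"
  have "inj_on ?f Z"
  proof (rule inj_onI)
    fix x y assume xy: "x \<in> Z" "y \<in> Z" "?f x = ?f y"
    then have "x mod int N = y mod int N"
      using assms(2) by (simp only: mod_eq_dvd_iff)
    then show "x = y" using xy by simp
  qed
  moreover have "?f ` Z \<subseteq> Z" by auto
  ultimately have "bij_betw ?f Z Z"
    by (simp add: bij_betw_def endo_inj_surj)
  then have "(\<Sum>x\<in>Z. g (?f x)) = (\<Sum>x\<in>Z. g x)"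
    by (rule sum.reindex_bij_betw)
  moreover have "g (?f x) = g (\<phi> x)" for x
    using assms(1) by (simp add: periodic_def)
  ultimately show ?thesis by simp
qed

lemma sum_shift: "periodic g \<Longrightarrow> (\<Sum>x\<in>Z. g (x + c)) = (\<Sum>x\<in>Z. g x)"
  by (rule sum_reindex_periodic) auto

lemma sum_shift': "periodic g \<Longrightarrow> (\<Sum>x\<in>Z. g (c + x)) = (\<Sum>x\<in>Z. g x)"
  by (rule sum_reindex_periodic) auto

lemma sum_dilate:
  assumes "periodic g" "coprime m (int N)"
  shows "(\<Sum>x\<in>Z. g (m * x)) = (\<Sum>x\<in>Z. g x)"
  using assms(2) by (intro sum_reindex_periodic[OF assms(1)])
    (simp add: right_diff_distrib[symmetric] coprime_dvd_mult_right_iff coprime_commute)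

lemma sum_e: "(\<Sum>r\<in>Z. e (r * k)) = (if int N dvd k then of_nat N else 0)"
proof (cases "int N dvd k")
  case True
  then have "e (r * k) = 1" for r by (simp add: e_eq_1_iff)
  then show ?thesis using True by simp
next
  case False
  \<comment> \<open>Shifting the summation variable multiplies the sum by \<open>e k\<close>, which
    differs from 1, so the sum vanishes.\<close>
  have "(\<Sum>r\<in>Z. e (r * k)) = (\<Sum>r\<in>Z. e ((r + 1) * k))"
    by (rule sum_shift[symmetric]) simp
  also have "\<dots> = (\<Sum>r\<in>Z. e (r * k)) * e k"
    by (simp add: distrib_right e_add sum_distrib_right)
  finally have "(\<Sum>r\<in>Z. e (r * k)) * (e k - 1) = 0"
    by (simp add: right_diff_distrib)
  then show ?thesis using False by (simp add: e_eq_1_iff)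
qed

text \<open>Orthogonality of characters. The frequency is negated because \<open>dft\<close> itself
  is taken with a positive exponent.\<close>

lemma dft_inversion:
  assumes "periodic g"
  shows "(\<Sum>r\<in>Z. dft g (- r) * e (r * k)) = of_real (real N * g k)"
proof -
  have "(\<Sum>r\<in>Z. dft g (- r) * e (r * k)) =
        (\<Sum>r\<in>Z. \<Sum>x\<in>Z. of_real (g x) * e (r * (k - x)))"
    by (simp add: dft_def sum_distrib_right right_diff_distrib e_diff mult.assoc mult.commute[of "e (_ * k)"])
  also have "\<dots> = (\<Sum>x\<in>Z. of_real (g x) * (\<Sum>r\<in>Z. e (r * (k - x))))"
    by (subst sum.swap) (simp add: sum_distrib_left)
  also have "\<dots> = (\<Sum>x\<in>Z. if x = k mod int N then of_real (g x) * of_nat N else 0)"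
  proof (intro sum.cong refl)
    fix x assume "x \<in> Z"
    then have "int N dvd k - x \<longleftrightarrow> x = k mod int N"
      by (metis mod_Z mod_eq_dvd_iff)
    then show "of_real (g x) * (\<Sum>r\<in>Z. e (r * (k - x))) =
        (if x = k mod int N then of_real (g x) * of_nat N else 0)"
      by (simp add: sum_e)
  qed
  also have "\<dots> = of_real (g k) * of_nat N"
    using assms by (simp add: periodic_def)
  finally show ?thesis by (simp add: mult.commute)
qed

lemma cnj_dft: "cnj (dft g r) = dft g (- r)"
  by (simp add: dft_def cnj_e)

lemma dft_times: "dft g r * w = (\<Sum>x\<in>Z. of_real (g x) * (w * e (r * x)))"
  by (simp add: dft_def sum_distrib_right mult.assoc mult.commute[of w])

lemma parseval:
  assumes "periodic g"
  shows "(\<Sum>r\<in>Z. (cmod (dft g r))\<^sup>2) = real N * (\<Sum>x\<in>Z. (g x)\<^sup>2)"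
proof -
  have "complex_of_real (\<Sum>r\<in>Z. (cmod (dft g r))\<^sup>2) = (\<Sum>r\<in>Z. dft g r * dft g (- r))"
    by (simp only: of_real_sum complex_norm_square cnj_dft)
  also have "\<dots> = (\<Sum>r\<in>Z. \<Sum>x\<in>Z. of_real (g x) * (dft g (- r) * e (r * x)))"
    by (simp only: dft_times)
  also have "\<dots> = (\<Sum>x\<in>Z. of_real (g x) * (\<Sum>r\<in>Z. dft g (- r) * e (r * x)))"
    by (subst sum.swap) (simp add: sum_distrib_left)
  also have "\<dots> = complex_of_real (real N * (\<Sum>x\<in>Z. (g x)\<^sup>2))"
    unfolding dft_inversion[OF assms]
    by (simp add: sum_distrib_left power2_eq_square mult.left_commute)
  finally show ?thesis by (simp only: of_real_eq_iff)
qed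

section \<open>Convolutions and shifts on the Fourier side\<close>

lemma periodic_conv:
  assumes "periodic k" shows "periodic (conv g k)"
  unfolding conv_def
  by (intro periodic_sum periodic_mult[OF _ periodic_shift'[OF assms]]) (simp add: periodic_def)

lemma dft_conv:
  assumes "periodic k"
  shows "dft (conv g k) r = dft g r * dft k r"
proof -
  have "dft (conv g k) r =
      (\<Sum>x\<in>Z. \<Sum>y\<in>Z. of_real (g y) * (of_real (k (x - y)) * e (r * x)))"
    by (simp add: dft_def conv_def sum_distrib_right mult.assoc)
  also have "\<dots> = (\<Sum>y\<in>Z. of_real (g y) * (\<Sum>x\<in>Z. of_real (k (x - y)) * e (r * x)))"
    by (subst sum.swap) (simp add: sum_distrib_left)
  also have "\<dots> = (\<Sum>y\<in>Z. of_real (g y) * (e (r * y) * dft k r))"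
  proof (intro sum.cong refl arg_cong2[where f = "(*)"])
    fix y
    have "periodic (\<lambda>x. complex_of_real (k (x - y)) * e (r * x))"
      using periodic_shift'[OF assms, of y] by (intro periodic_mult) (simp_all add: periodic_def)
    from sum_shift[OF this, of y, symmetric]
    show "(\<Sum>x\<in>Z. of_real (k (x - y)) * e (r * x)) = e (r * y) * dft k r"
      by (simp add: dft_def distrib_left e_add sum_distrib_left mult.left_commute mult.commute[of "e (r * y)"])
  qed
  also have "\<dots> = dft g r * dft k r"
    by (simp add: dft_def[of g] sum_distrib_right mult.assoc)
  finally show ?thesis .
qed

lemma dft_shift:
  assumes "periodic g"
  shows "dft (\<lambda>x. g (x + b)) r = e (- (r * b)) * dft g r"
proof -
  have "periodic (\<lambda>x. complex_of_real (g x) * e (r * (x - b)))"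
    using assms periodic_shift'[OF periodic_e_mult(1), of r b]
    by (intro periodic_mult) (simp_all add: periodic_def)
  from sum_shift[OF this, of b] show ?thesis
    by (simp add: dft_def right_diff_distrib e_diff sum_distrib_left mult_ac)
qed

section \<open>Solutions of the equation counted by Fourier coefficients\<close>

definition sol_sum :: "(int \<Rightarrow> real) \<Rightarrow> real" where
  "sol_sum g = (\<Sum>x1\<in>Z. \<Sum>x2\<in>Z. \<Sum>x3\<in>Z. \<Sum>x5\<in>Z.
     g x1 * g x2 * g x3 * g x5 * g (x1 + x2 + 2 * x3 - 3 * x5))"

text \<open>Expanding one Fourier coefficient moves its variable into the phase. Repeating this
  absorbs the variables one at a time and leaves an inversion sum at the end.\<close>

lemma sum_dft_mult_e:
  "(\<Sum>r\<in>Z. (dft g (m * r) * w r) * e (r * k)) =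
   (\<Sum>x\<in>Z. of_real (g x) * (\<Sum>r\<in>Z. w r * e (r * (m * x + k))))"
proof -
  have "(dft g (m * r) * w r) * e (r * k) =
        (\<Sum>x\<in>Z. of_real (g x) * (w r * e (r * (m * x + k))))" for r
    by (simp add: dft_times mult.assoc mult.left_commute[of m r] sum_distrib_right distrib_left e_add)
  then show ?thesis
    by (simp add: sum_distrib_left) (rule sum.swap)
qed

text \<open>The multipliers 1, 1, 2, -3, -1 are the coefficients of the equation with everything on
  one side. The factor at \<open>- r\<close> belongs to \<open>x4\<close>: inversion evaluates
  \<open>g\<close> at the value that the other four variables force, which is why
  \<open>sol_sum\<close> has no sum over \<open>x4\<close>.\<close>

lemma dft_sol_sum:
  assumes "periodic g"
  shows "(\<Sum>r\<in>Z. dft g r * dft g r * dft g (2 * r) * dft g (- 3 * r) * dft g (- r)) =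
    of_real (real N * sol_sum g)"
proof -
  \<comment> \<open>The padding by \<open>1 * r\<close> and \<open>e (r * 0)\<close> brings the sum
    into the shape of \<open>sum_dft_mult_e\<close>.\<close>
  have "(\<Sum>r\<in>Z. dft g r * dft g r * dft g (2 * r) * dft g (- 3 * r) * dft g (- r)) =
    (\<Sum>r\<in>Z. (dft g (1 * r) * (dft g (1 * r) * (dft g (2 * r) * (dft g (- 3 * r) * dft g (- r))))) *
      e (r * 0))"
    by (simp add: mult.assoc)
  also have "\<dots> = (\<Sum>x1\<in>Z. of_real (g x1) * (\<Sum>x2\<in>Z. of_real (g x2) *
      (\<Sum>x3\<in>Z. of_real (g x3) * (\<Sum>x5\<in>Z. of_real (g x5) *
      (\<Sum>r\<in>Z. dft g (- r) * e (r * (-3 * x5 + (2 * x3 + (1 * x2 + (1 * x1 + 0))))))))))"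
    by (simp only: sum_dft_mult_e)
  also have "\<dots> = of_real (real N * sol_sum g)"
    unfolding dft_inversion[OF assms] sol_sum_def of_real_mult of_real_sum sum_distrib_left
    by (intro sum.cong refl) (simp add: algebra_simps)
  finally show ?thesis .
qed

section \<open>Sidon sets and their averages\<close>

lemma sum_ind: "B \<subseteq> Z \<Longrightarrow> (\<Sum>x\<in>Z. ind B x) = real (card B)"
proof -
  assume B: "B \<subseteq> Z"
  have "(\<Sum>x\<in>Z. ind B x) = (\<Sum>x\<in>Z. if x \<in> B then 1 else 0)"
    by (intro sum.cong refl) (simp add: ind_def)
  also have "\<dots> = real (card (Z \<inter> B))" by (simp add: sum.If_cases)
  finally show ?thesis using B by (simp add: Int_absorb1)
qed

lemma sum_conv:
  assumes "periodic k"
  shows "(\<Sum>x\<in>Z. conv g k x) = (\<Sum>x\<in>Z. g x) * (\<Sum>x\<in>Z. k x)"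
proof -
  have "(\<Sum>x\<in>Z. conv g k x) = (\<Sum>y\<in>Z. g y * (\<Sum>x\<in>Z. k (x - y)))"
    unfolding conv_def by (subst sum.swap) (simp add: sum_distrib_left)
  also have "\<dots> = (\<Sum>y\<in>Z. g y * (\<Sum>x\<in>Z. k x))"
    using sum_shift[OF assms, of "- y" for y] by simp
  finally show ?thesis by (simp add: sum_distrib_right)
qed

lemma ind_nonneg [simp]: "ind B x \<ge> 0" by (simp add: ind_def)

lemma conv_ind_nonneg: "conv (ind A) (ind B) x \<ge> 0"
  by (simp add: conv_def sum_nonneg)

definition sidon :: "int set \<Rightarrow> bool" where
  "sidon A \<longleftrightarrow> A \<subseteq> Z \<and> (\<forall>a\<in>A. \<forall>b\<in>A. \<forall>c\<in>A. \<forall>d\<in>A.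
     int N dvd (a + b) - (c + d) \<longrightarrow> a = c \<and> b = d \<or> a = d \<and> b = c)"

lemma sidonD:
  assumes "sidon A" "a \<in> A" "b \<in> A" "c \<in> A" "d \<in> A" "int N dvd (a + b) - (c + d)"
  shows "a = c \<and> b = d \<or> a = d \<and> b = c"
  using assms unfolding sidon_def by blast

lemma sidon_finite: "sidon A \<Longrightarrow> finite A"
  unfolding sidon_def using finite_Z finite_subset by blast

lemma sum_ind_mult:
  assumes "A \<subseteq> Z"
  shows "(\<Sum>y\<in>Z. ind A y * F y) = (\<Sum>y\<in>A. F y)"
proof -
  have "(\<Sum>y\<in>Z. ind A y * F y) = (\<Sum>y\<in>A. ind A y * F y)"
    by (intro sum.mono_neutral_right finite_Z assms) (simp add: ind_def)
  also have "\<dots> = (\<Sum>y\<in>A. F y)"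
    using assms by (intro sum.cong refl) (simp add: ind_def subset_iff)
  finally show ?thesis .
qed

text \<open>The convolution counts ordered pairs from \<open>A\<close> with sum \<open>x\<close>
  modulo \<open>N\<close>, and any two such pairs agree up to order.\<close>

lemma sidon_conv_le_2:
  assumes "sidon A"
  shows "conv (ind A) (ind A) x \<le> 2"
proof -
  have AZ: "A \<subseteq> Z" using assms by (simp add: sidon_def)
  let ?P = "{y\<in>A. (x - y) mod int N \<in> A}"
  have fin: "finite A" using assms by (rule sidon_finite)
  have "conv (ind A) (ind A) x = (\<Sum>y\<in>A. ind A (x - y))"
    by (simp add: conv_def sum_ind_mult[OF AZ])
  also have "\<dots> = real (card (A \<inter> {y. (x - y) mod int N \<in> A}))"
    using fin by (simp add: ind_def sum.If_cases)
  also have "A \<inter> {y. (x - y) mod int N \<in> A} = ?P" by auto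
  also have "card ?P \<le> 2"
  proof (cases "?P = {}")
    case False
    then obtain z where z: "z \<in> A" "(x - z) mod int N \<in> A" by auto
    have "?P \<subseteq> {z, (x - z) mod int N}"
    proof
      fix y assume "y \<in> ?P"
      then have y: "y \<in> A" "(x - y) mod int N \<in> A" by auto
      have "(y + (x - y) mod int N) mod int N = (z + (x - z) mod int N) mod int N"
        by (simp add: mod_add_right_eq)
      then have "int N dvd (y + (x - y) mod int N) - (z + (x - z) mod int N)"
        by (simp only: mod_eq_dvd_iff)
      from sidonD[OF assms y z this] show "y \<in> {z, (x - z) mod int N}" by blast
    qed
    then have "card ?P \<le> card {z, (x - z) mod int N}" by (rule card_mono[rotated]) simp
    also have "\<dots> \<le> 2" by (simp add: card_insert_if)
    finally show ?thesis .
  qed (metis card.empty zero_le)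
  finally show ?thesis by simp
qed

text \<open>Parseval for the self-convolution turns the fourth moment into a second moment, and the
  pointwise bound 2 reduces that to the total mass.\<close>

lemma sidon_fourth_moment:
  assumes "sidon A"
  shows "(\<Sum>r\<in>Z. cmod (dft (ind A) r) ^ 4) \<le> 2 * real N * (real (card A))\<^sup>2"
proof -
  have AZ: "A \<subseteq> Z" using assms by (simp add: sidon_def)
  let ?c = "conv (ind A) (ind A)"
  have "(\<Sum>r\<in>Z. cmod (dft (ind A) r) ^ 4) = (\<Sum>r\<in>Z. (cmod (dft ?c r))\<^sup>2)"
    by (simp add: dft_conv norm_mult power4_eq_xxxx power2_eq_square mult.assoc)
  also have "\<dots> = real N * (\<Sum>x\<in>Z. (?c x)\<^sup>2)"
    by (intro parseval periodic_conv periodic_ind)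
  also have "\<dots> \<le> real N * (\<Sum>x\<in>Z. 2 * ?c x)"
    unfolding power2_eq_square
    by (intro mult_left_mono sum_mono mult_right_mono sidon_conv_le_2 assms conv_ind_nonneg) simp
  also have "(\<Sum>x\<in>Z. 2 * ?c x) = 2 * (real (card A))\<^sup>2"
    by (simp add: sum_distrib_left[symmetric] sum_conv sum_ind[OF AZ] power2_eq_square)
  finally show ?thesis by simp
qed

text \<open>Expanding the square gives the sum of \<open>W (a - a')\<close> over pairs from
  \<open>A\<close>, where \<open>W d\<close> counts the pairs in \<open>B\<close> with difference
  \<open>d\<close>. The diagonal contributes the product term. Off the diagonal the differences are
  distinct modulo \<open>N\<close>, so they contribute at most the total mass of
  \<open>W\<close>.\<close>

lemma sidon_conv_square_sum:
  assumes "sidon A" "B \<subseteq> Z"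
  shows "(\<Sum>x\<in>Z. (conv (ind A) (ind B) x)\<^sup>2) \<le> (real (card B))\<^sup>2 + real (card A) * real (card B)"
proof -
  have AZ: "A \<subseteq> Z" using assms by (simp add: sidon_def)
  have fin: "finite A" using assms(1) by (rule sidon_finite)
  define W where "W d = (\<Sum>x\<in>Z. ind B x * ind B (x + d))" for d
  have per: "periodic (\<lambda>x. ind B x * ind B (x + d))" for d
    by (intro periodic_mult periodic_shift periodic_ind)
  have Wper: "periodic W"
    unfolding W_def
    by (intro periodic_sum periodic_mult)
      (use periodic_shift[OF periodic_ind[of B]] in \<open>simp_all add: periodic_def add.commute\<close>)
  have W0: "W d \<ge> 0" for d by (simp add: W_def sum_nonneg)
  have Wz: "W 0 = real (card B)"
    using sum_ind[OF assms(2)] by (simp add: W_def ind_def if_distrib cong: if_cong)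
  have sumW: "(\<Sum>d\<in>Z. W d) = (real (card B))\<^sup>2"
  proof -
    have "(\<Sum>d\<in>Z. W d) = (\<Sum>x\<in>Z. ind B x * (\<Sum>d\<in>Z. ind B (x + d)))"
      unfolding W_def by (subst sum.swap) (simp add: sum_distrib_left)
    also have "\<dots> = (real (card B))\<^sup>2"
      by (simp add: sum_shift' sum_ind[OF assms(2)] sum_distrib_right[symmetric] power2_eq_square)
    finally show ?thesis .
  qed
  have pair: "(\<Sum>x\<in>Z. ind B (x - a) * ind B (x - a')) = W (a - a')" for a a'
    using sum_shift[OF per[of "a - a'"], of "- a"] by (simp add: W_def)
  have "(\<Sum>x\<in>Z. (conv (ind A) (ind B) x)\<^sup>2) =
    (\<Sum>x\<in>Z. \<Sum>a\<in>A. \<Sum>a'\<in>A. ind B (x - a) * ind B (x - a'))"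
    by (simp add: conv_def sum_ind_mult[OF AZ] power2_eq_square sum_product)
  also have "\<dots> = (\<Sum>a\<in>A. \<Sum>a'\<in>A. W (a - a'))"
    unfolding pair[symmetric] by (rule trans[OF sum.swap], rule sum.cong[OF refl], rule sum.swap)
  also have "\<dots> = (\<Sum>p\<in>A \<times> A. W (fst p - snd p))"
    by (simp add: sum.cartesian_product case_prod_beta)
  also have "\<dots> = (\<Sum>p\<in>{p\<in>A \<times> A. fst p = snd p}. W (fst p - snd p)) +
     (\<Sum>p\<in>{p\<in>A \<times> A. fst p \<noteq> snd p}. W (fst p - snd p))"
    using fin by (subst sum.union_disjoint[symmetric]) (auto intro!: sum.cong)
  also have "(\<Sum>p\<in>{p\<in>A \<times> A. fst p = snd p}. W (fst p - snd p)) = real (card A) * real (card B)"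
  proof -
    have "{p\<in>A \<times> A. fst p = snd p} = (\<lambda>a. (a, a)) ` A" by auto
    moreover have "card ((\<lambda>a. (a, a)) ` A) = card A" by (intro card_image inj_onI) simp
    moreover have "(\<Sum>p\<in>{p\<in>A \<times> A. fst p = snd p}. W (fst p - snd p)) =
        (\<Sum>p\<in>{p\<in>A \<times> A. fst p = snd p}. W 0)"
      by (intro sum.cong refl) auto
    ultimately show ?thesis by (simp add: Wz)
  qed
  also have "(\<Sum>p\<in>{p\<in>A \<times> A. fst p \<noteq> snd p}. W (fst p - snd p)) \<le> (real (card B))\<^sup>2"
  proof -
    let ?O = "{p\<in>A \<times> A. fst p \<noteq> snd p}"
    let ?f = "\<lambda>p. (fst p - snd p) mod int N"
    have inj: "inj_on ?f ?O"
    proof (rule inj_onI)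
      fix p q assume p: "p \<in> ?O" and q: "q \<in> ?O" and eq: "?f p = ?f q"
      have "int N dvd (fst p - snd p) - (fst q - snd q)"
        using eq by (simp only: mod_eq_dvd_iff)
      then have "int N dvd (fst p + snd q) - (fst q + snd p)"
        by (simp add: algebra_simps)
      then have "fst p = fst q \<and> snd q = snd p \<or> fst p = snd p \<and> snd q = fst q"
        using p q by (intro sidonD[OF assms(1)]) auto
      then show "p = q" using p by (auto simp: prod_eq_iff)
    qed
    have "(\<Sum>p\<in>?O. W (fst p - snd p)) = (\<Sum>p\<in>?O. W (?f p))"
      using Wper by (simp add: periodic_def)
    also have "\<dots> = (\<Sum>d\<in>?f ` ?O. W d)"
      by (simp add: sum.reindex[OF inj])
    also have "\<dots> \<le> (\<Sum>d\<in>Z. W d)"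
      by (intro sum_mono2) (auto simp: W0)
    finally show ?thesis by (simp add: sumW)
  qed
  finally show ?thesis by simp
qed

text \<open>For \<open>B = Z\<close> the convolution is constantly \<open>a = card A\<close>, and
  the previous bound becomes \<open>a\<^sup>2 \<le> N + a\<close>. Unless \<open>a\<close> is at
  most 1, the linear term is at most half of the square.\<close>

lemma sidon_card_square:
  assumes "sidon A"
  shows "(real (card A))\<^sup>2 \<le> 2 * real N"
proof -
  let ?a = "real (card A)"
  have AZ: "A \<subseteq> Z" using assms by (simp add: sidon_def)
  have "conv (ind A) (ind Z) x = ?a" for x
    by (simp add: conv_def sum_ind_mult[OF AZ]) (simp add: ind_def)
  then have "real N * ?a\<^sup>2 \<le> (real N)\<^sup>2 + ?a * real N"
    using sidon_conv_square_sum[OF assms order.refl] by simp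
  then have "real N * ?a\<^sup>2 \<le> real N * (real N + ?a)"
    by (simp add: power2_eq_square algebra_simps)
  then have *: "?a\<^sup>2 \<le> real N + ?a" using N_pos by simp
  show ?thesis
  proof (cases "?a \<le> 1")
    case True
    then have "?a\<^sup>2 \<le> 1" by (simp add: power_le_one)
    then show ?thesis using N_pos by simp
  next
    case False
    then have "2 * ?a \<le> ?a * ?a" by (intro mult_right_mono) auto
    then show ?thesis using * unfolding power2_eq_square by linarith
  qed
qed

section \<open>Averages of the indicator function over a set of translations\<close>

definition smooth :: "int set \<Rightarrow> int set \<Rightarrow> int \<Rightarrow> real" where
  "smooth A B x = sqrt (real N) / real (card B) * conv (ind A) (ind B) x"

text \<open>Fourier transform of the uniform probability measure on \<open>B\<close>; averaging over
  \<open>B\<close> multiplies Fourier coefficients by it.\<close>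

definition bhat :: "int set \<Rightarrow> int \<Rightarrow> complex" where
  "bhat B r = dft (ind B) r / of_nat (card B)"

lemma smooth_nonneg: "smooth A B x \<ge> 0"
  by (simp add: smooth_def conv_ind_nonneg)

lemma periodic_smooth: "periodic (smooth A B)"
  using periodic_conv[OF periodic_ind, of "ind A" B] by (simp add: periodic_def smooth_def)

text \<open>The factor \<open>sqrt N\<close> in \<open>smooth\<close> is chosen for this: the mean
  becomes \<open>card A / sqrt N\<close>, which is bounded below for a dense set and unaffected by
  the averaging.\<close>

lemma sum_smooth:
  assumes "A \<subseteq> Z" "B \<subseteq> Z" "B \<noteq> {}"
  shows "(\<Sum>x\<in>Z. smooth A B x) = sqrt (real N) * real (card A)"
proof -
  have "card B \<noteq> 0" using assms finite_subset[OF assms(2)] by auto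
  then show ?thesis
    unfolding smooth_def sum_distrib_left[symmetric]
    using assms by (simp add: sum_conv sum_ind)
qed

lemma sum_smooth_square:
  assumes "sidon A" "B \<subseteq> Z" "B \<noteq> {}"
  shows "(\<Sum>x\<in>Z. (smooth A B x)\<^sup>2) \<le> real N * (1 + real (card A) / real (card B))"
proof -
  have B: "real (card B) > 0" using assms finite_subset[OF assms(2)] by (auto simp: card_gt_0_iff)
  have "(\<Sum>x\<in>Z. (smooth A B x)\<^sup>2) =
    real N / (real (card B))\<^sup>2 * (\<Sum>x\<in>Z. (conv (ind A) (ind B) x)\<^sup>2)"
    by (simp add: smooth_def power_mult_distrib power_divide sum_distrib_left)
  also have "\<dots> \<le> real N / (real (card B))\<^sup>2 * ((real (card B))\<^sup>2 + real (card A) * real (card B))"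
    by (intro mult_left_mono sidon_conv_square_sum assms) simp
  also have "\<dots> = real N * (1 + real (card A) / real (card B))"
    using B by (simp add: field_simps power2_eq_square)
  finally show ?thesis .
qed

lemma dft_scale: "dft (\<lambda>x. c * g x) r = of_real c * dft g r"
  by (simp add: dft_def sum_distrib_left mult.assoc)

lemma dft_smooth: "dft (smooth A B) r = of_real (sqrt (real N)) * dft (ind A) r * bhat B r"
proof -
  have "smooth A B = (\<lambda>x. sqrt (real N) / real (card B) * conv (ind A) (ind B) x)"
    by (simp add: smooth_def fun_eq_iff)
  then show ?thesis by (simp only: dft_scale) (simp add: dft_conv bhat_def)
qed

lemma norm_dft_ind: "B \<subseteq> Z \<Longrightarrow> cmod (dft (ind B) r) \<le> real (card B)"
  unfolding dft_def sum_ind[symmetric]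
  by (rule order.trans[OF norm_sum]) (simp add: norm_mult)

lemma norm_bhat: "B \<subseteq> Z \<Longrightarrow> cmod (bhat B r) \<le> 1"
  using norm_dft_ind[of B r] by (simp add: bhat_def norm_divide divide_le_eq)

lemma sum_bhat_square:
  assumes "B \<subseteq> Z" "B \<noteq> {}"
  shows "(\<Sum>r\<in>Z. (cmod (bhat B r))\<^sup>2) = real N / real (card B)"
proof -
  have B: "real (card B) > 0" using assms finite_subset[OF assms(1)] by (auto simp: card_gt_0_iff)
  have "(\<Sum>r\<in>Z. (cmod (bhat B r))\<^sup>2) = real N * (\<Sum>x\<in>Z. (ind B x)\<^sup>2) / (real (card B))\<^sup>2"
    by (simp add: bhat_def norm_divide power_divide sum_divide_distrib[symmetric] parseval)
  also have "(\<Sum>x\<in>Z. (ind B x)\<^sup>2) = real (card B)"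
    unfolding sum_ind[OF assms(1), symmetric] by (intro sum.cong refl) (simp add: ind_def)
  finally show ?thesis using B by (simp add: power2_eq_square)
qed

lemma bhat_near_1:
  assumes "B \<subseteq> Z" "B \<noteq> {}" "\<And>x. x \<in> B \<Longrightarrow> cmod (e (r * x) - 1) \<le> \<eta>"
  shows "cmod (bhat B r - 1) \<le> \<eta>"
proof -
  have B: "real (card B) > 0" using assms finite_subset[OF assms(1)] by (auto simp: card_gt_0_iff)
  have "dft (ind B) r = (\<Sum>x\<in>B. e (r * x))"
  proof -
    have "dft (ind B) r = (\<Sum>x\<in>B. of_real (ind B x) * e (r * x))"
      unfolding dft_def by (intro sum.mono_neutral_right finite_Z assms) (simp add: ind_def)
    also have "\<dots> = (\<Sum>x\<in>B. e (r * x))"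
      using assms(1) by (intro sum.cong refl) (simp add: ind_def subset_iff)
    finally show ?thesis .
  qed
  then have "bhat B r - 1 = (\<Sum>x\<in>B. e (r * x) - 1) / of_nat (card B)"
    using B by (simp add: bhat_def sum_subtractf field_simps)
  moreover have "cmod (\<Sum>x\<in>B. e (r * x) - 1) \<le> (\<Sum>x\<in>B. \<eta>)"
    by (rule order.trans[OF norm_sum]) (intro sum_mono assms(3))
  ultimately show ?thesis using B by (simp add: norm_divide divide_le_eq mult.commute)
qed

end

section \<open>Weighted solution counts\<close>

lemma amgm4:
  fixes a b c d :: real
  shows "a * b * c * d \<le> (a ^ 4 + b ^ 4 + c ^ 4 + d ^ 4) / 4"
proof -
  have "a * b * c * d \<le> ((a * b)\<^sup>2 + (c * d)\<^sup>2) / 2"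
    using sum_squares_bound[of "a * b" "c * d"] by (simp add: mult.assoc)
  also have "(a * b)\<^sup>2 \<le> (a ^ 4 + b ^ 4) / 2"
    using sum_squares_bound[of "a\<^sup>2" "b\<^sup>2"] by (simp add: power_mult_distrib)
  also have "(c * d)\<^sup>2 \<le> (c ^ 4 + d ^ 4) / 2"
    using sum_squares_bound[of "c\<^sup>2" "d\<^sup>2"] by (simp add: power_mult_distrib)
  finally show ?thesis by (simp add: field_simps)
qed

text \<open>Lets a product of numbers in the unit disc be compared with 1 one factor at a
  time.\<close>

lemma norm_one_minus_mult:
  fixes x y :: complex
  assumes "cmod x \<le> 1"
  shows "cmod (1 - x * y) \<le> cmod (1 - x) + cmod (1 - y)"
proof -
  have "1 - x * y = (1 - x) + x * (1 - y)" by (simp add: algebra_simps)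
  then have "cmod (1 - x * y) \<le> cmod (1 - x) + cmod x * cmod (1 - y)"
    by (metis norm_mult norm_triangle_ineq)
  also have "cmod x * cmod (1 - y) \<le> 1 * cmod (1 - y)"
    using assms by (intro mult_right_mono) auto
  finally show ?thesis by simp
qed

context residue_fourier
begin

text \<open>AM-GM separates the four factors; a multiplier coprime to \<open>N\<close> then only
  permutes the frequencies.\<close>

lemma sum_dilated_four:
  assumes "periodic F" "coprime m1 (int N)" "coprime m2 (int N)" "coprime m3 (int N)"
    "coprime m4 (int N)"
  shows "(\<Sum>r\<in>Z. F (m1 * r) * F (m2 * r) * F (m3 * r) * F (m4 * r)) \<le> (\<Sum>r\<in>Z. F r ^ 4 :: real)"
proof -
  have *: "(\<Sum>r\<in>Z. F (m * r) ^ 4) = (\<Sum>r\<in>Z. F r ^ 4)" if "coprime m (int N)" for m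
    using sum_dilate[OF periodic_comp[OF assms(1), of "\<lambda>x. x ^ 4"] that] .
  have "(\<Sum>r\<in>Z. F (m1 * r) * F (m2 * r) * F (m3 * r) * F (m4 * r)) \<le>
    (\<Sum>r\<in>Z. (F (m1 * r) ^ 4 + F (m2 * r) ^ 4 + F (m3 * r) ^ 4 + F (m4 * r) ^ 4) / 4)"
    by (intro sum_mono amgm4)
  also have "\<dots> = (\<Sum>r\<in>Z. F r ^ 4)"
    using assms by (simp add: sum_divide_distrib[symmetric] sum.distrib *)
  finally show ?thesis .
qed

text \<open>Replacing one factor of the five costs \<open>\<theta>\<close>; by AM-GM the other four are controlled by the
  fourth moment.\<close>

lemma sol_sum_smooth_approx:
  assumes A: "sidon A" and B: "B \<subseteq> Z"
    and cop: "coprime 2 (int N)" "coprime 3 (int N)"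
    and \<theta>: "\<And>r. cmod (dft (ind A) r) * cmod (1 - bhat B r) \<le> \<theta>"
  shows "\<bar>real N ^ 2 * sqrt (real N) * sol_sum (ind A) - sol_sum (smooth A B)\<bar> \<le>
    20 * \<theta> * real N ^ 3 * sqrt (real N)"
proof -
  define S where "S = dft (ind A)"
  define F where "F r = cmod (S r)" for r
  define P where "P r = S r * S r * S (2 * r) * S (- 3 * r) * S (- r)" for r
  define b where "b = bhat B"
  \<comment> \<open>Nested to the right so that \<open>norm_one_minus_mult\<close> peels off the
    factors in turn.\<close>
  define Q where "Q r = b r * (b r * (b (2 * r) * (b (- 3 * r) * b (- r))))" for r
  let ?E = "\<Sum>r\<in>Z. F r ^ 4"
  have F0: "F r \<ge> 0" for r by (simp add: F_def)
  have Fper: "periodic F" unfolding F_def S_def by (rule periodic_comp[OF periodic_dft])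
  have nb: "cmod (b r) \<le> 1" for r unfolding b_def by (rule norm_bhat[OF B])
  have \<theta>': "F r * cmod (1 - b r) \<le> \<theta>" for r using \<theta>[of r] by (simp add: F_def S_def b_def)
  have \<theta>0: "\<theta> \<ge> 0" using order.trans[OF _ \<theta>, of 0 0] by simp
  have cops: "coprime 1 (int N)" "coprime (- 3) (int N)" "coprime (- 1) (int N)" "coprime 2 (int N)"
    using cop by simp_all
  \<comment> \<open>Each term \<open>1 - b\<close> is paired with the factor \<open>F\<close> at the
    same frequency and bounded by \<open>\<theta>\<close>; four factors remain. Writing
    \<open>1 * r\<close> keeps them in the shape of \<open>sum_dilated_four\<close>.\<close>
  have pt: "cmod (P r * (1 - Q r)) \<le> \<theta> *
     (F (1 * r) * F (2 * r) * F (- 3 * r) * F (- 1 * r) +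
      F (1 * r) * F (2 * r) * F (- 3 * r) * F (- 1 * r) +
      F (1 * r) * F (1 * r) * F (- 3 * r) * F (- 1 * r) +
      F (1 * r) * F (1 * r) * F (2 * r) * F (- 1 * r) +
      F (1 * r) * F (1 * r) * F (2 * r) * F (- 3 * r))" for r
  proof -
    have Q: "cmod (1 - Q r) \<le> cmod (1 - b r) + (cmod (1 - b r) + (cmod (1 - b (2 * r)) +
       (cmod (1 - b (- 3 * r)) + cmod (1 - b (- r)))))"
      unfolding Q_def
      by (intro order.trans[OF norm_one_minus_mult[OF nb]] add_mono order.refl)
    have "cmod (P r * (1 - Q r)) = F r * F r * F (2 * r) * F (- 3 * r) * F (- r) * cmod (1 - Q r)"
      by (simp add: P_def F_def norm_mult)
    also have "\<dots> \<le> F r * F r * F (2 * r) * F (- 3 * r) * F (- r) *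
      (cmod (1 - b r) + (cmod (1 - b r) + (cmod (1 - b (2 * r)) +
       (cmod (1 - b (- 3 * r)) + cmod (1 - b (- r))))))"
      using Q by (intro mult_left_mono mult_nonneg_nonneg F0)
    also have "\<dots> = (F r * cmod (1 - b r)) * (F r * F (2 * r) * F (- 3 * r) * F (- r)) +
      (F r * cmod (1 - b r)) * (F r * F (2 * r) * F (- 3 * r) * F (- r)) +
      (F (2 * r) * cmod (1 - b (2 * r))) * (F r * F r * F (- 3 * r) * F (- r)) +
      (F (- 3 * r) * cmod (1 - b (- 3 * r))) * (F r * F r * F (2 * r) * F (- r)) +
      (F (- r) * cmod (1 - b (- r))) * (F r * F r * F (2 * r) * F (- 3 * r))"
      by (simp add: algebra_simps)
    also have "\<dots> \<le> \<theta> * (F r * F (2 * r) * F (- 3 * r) * F (- r)) +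
      \<theta> * (F r * F (2 * r) * F (- 3 * r) * F (- r)) +
      \<theta> * (F r * F r * F (- 3 * r) * F (- r)) +
      \<theta> * (F r * F r * F (2 * r) * F (- r)) +
      \<theta> * (F r * F r * F (2 * r) * F (- 3 * r))"
      by (intro add_mono mult_right_mono \<theta>' mult_nonneg_nonneg F0)
    finally show ?thesis by (simp add: distrib_left)
  qed
  have "cmod (\<Sum>r\<in>Z. P r * (1 - Q r)) \<le> \<theta> * (?E + ?E + ?E + ?E + ?E)"
  proof -
    have "cmod (\<Sum>r\<in>Z. P r * (1 - Q r)) \<le> (\<Sum>r\<in>Z. \<theta> *
     (F (1 * r) * F (2 * r) * F (- 3 * r) * F (- 1 * r) +
      F (1 * r) * F (2 * r) * F (- 3 * r) * F (- 1 * r) +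
      F (1 * r) * F (1 * r) * F (- 3 * r) * F (- 1 * r) +
      F (1 * r) * F (1 * r) * F (2 * r) * F (- 1 * r) +
      F (1 * r) * F (1 * r) * F (2 * r) * F (- 3 * r)))"
      by (rule order.trans[OF norm_sum]) (intro sum_mono pt)
    also have "\<dots> \<le> \<theta> * (?E + ?E + ?E + ?E + ?E)"
      unfolding sum_distrib_left[symmetric] sum.distrib
      by (intro mult_left_mono add_mono sum_dilated_four Fper cops \<theta>0)
    finally show ?thesis .
  qed
  also have "\<dots> = 5 * \<theta> * ?E" by simp
  also have "?E \<le> 2 * real N * (2 * real N)"
  proof -
    have "?E \<le> 2 * real N * (real (card A))\<^sup>2"
      unfolding F_def S_def by (rule sidon_fourth_moment[OF A])
    also have "\<dots> \<le> 2 * real N * (2 * real N)"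
      by (intro mult_left_mono sidon_card_square[OF A]) simp
    finally show ?thesis .
  qed
  \<comment> \<open>The constant is five error terms times the bound \<open>4 * N\<^sup>2\<close>
    for the fourth moment.\<close>
  finally have main: "cmod (\<Sum>r\<in>Z. P r * (1 - Q r)) \<le> 20 * \<theta> * real N ^ 2"
    using \<theta>0 by (simp add: mult_left_mono power2_eq_square)
  have sA: "(\<Sum>r\<in>Z. P r) = of_real (real N * sol_sum (ind A))"
    unfolding P_def S_def by (rule dft_sol_sum[OF periodic_ind])
  have pow5: "x ^ 5 = x * x * x * x * x" for x :: real
    by (simp add: eval_nat_numeral)
  have "of_real (real N * sol_sum (smooth A B)) = (\<Sum>r\<in>Z. of_real (sqrt (real N) ^ 5) * (P r * Q r))"
    unfolding dft_sol_sum[OF periodic_smooth, symmetric] dft_smooth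
    by (rule sum.cong[OF refl]) (simp only: P_def Q_def S_def b_def of_real_mult pow5 mult_ac)
  \<comment> \<open>Each of the five factors \<open>smooth\<close> carries one
    \<open>sqrt N\<close>.\<close>
  also have "sqrt (real N) ^ 5 = real N ^ 2 * sqrt (real N)"
  proof -
    have "sqrt (real N) ^ 5 = ((sqrt (real N))\<^sup>2) ^ 2 * sqrt (real N)"
      by (simp only: pow5 power2_eq_square mult_ac)
    then show ?thesis by simp
  qed
  finally have sh: "of_real (real N * sol_sum (smooth A B)) =
     of_real (real N ^ 2 * sqrt (real N)) * (\<Sum>r\<in>Z. P r * Q r)"
    by (simp only: sum_distrib_left)
  have "complex_of_real (real N * (real N ^ 2 * sqrt (real N) * sol_sum (ind A) - sol_sum (smooth A B))) =
    of_real (real N ^ 2 * sqrt (real N)) * of_real (real N * sol_sum (ind A)) -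
      of_real (real N * sol_sum (smooth A B))"
    by (simp add: algebra_simps)
  also have "\<dots> = of_real (real N ^ 2 * sqrt (real N)) * (\<Sum>r\<in>Z. P r * (1 - Q r))"
    unfolding sh sA[symmetric] by (simp add: right_diff_distrib sum_subtractf)
  finally have "real N * \<bar>real N ^ 2 * sqrt (real N) * sol_sum (ind A) - sol_sum (smooth A B)\<bar> =
    real N ^ 2 * sqrt (real N) * cmod (\<Sum>r\<in>Z. P r * (1 - Q r))"
    by (metis (no_types, lifting) abs_mult abs_of_nat abs_of_nonneg norm_mult norm_of_real
        of_nat_0_le_iff of_nat_power real_sqrt_ge_zero zero_le_mult_iff)
  also have "\<dots> \<le> real N ^ 2 * sqrt (real N) * (20 * \<theta> * real N ^ 2)"
    by (intro mult_left_mono main) simp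
  also have "\<dots> = real N * (20 * \<theta> * real N ^ 3 * sqrt (real N))"
    by (simp add: power2_eq_square power3_eq_cube)
  finally show ?thesis using N_pos by simp
qed

text \<open>\<open>L\<^sup>1\<close>-invariance of \<open>h\<close> passes to \<open>min h 1\<close>, where products can be compared factor by factor.\<close>

lemma sol_sum_lower_bound:
  assumes per: "periodic h" and nn: "\<And>x. h x \<ge> 0" and D: "D \<subseteq> Z"
    and inv: "\<And>b. b \<in> D \<Longrightarrow> (\<Sum>x\<in>Z. \<bar>h (x + b) - h x\<bar>) \<le> \<delta> * real N"
    and m: "m \<ge> 0" "(\<Sum>x\<in>Z. min (h x) 1) \<ge> m * real N"
    and \<delta>: "5 * \<delta> \<le> m\<^sup>2" "2 * \<delta> \<le> m ^ 3"
  shows "sol_sum h \<ge> (real (card D))\<^sup>2 * ((m\<^sup>2 - 5 * \<delta>) * real N * ((m ^ 3 - 2 * \<delta>) * real N))"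
proof -
  define k where "k x = min (h x) 1" for x
  have k: "0 \<le> k x" "k x \<le> 1" "k x \<le> h x" for x using nn by (simp_all add: k_def)
  have kper: "periodic k" unfolding k_def by (rule periodic_comp[OF per])
  define d where "d b = (\<Sum>x\<in>Z. \<bar>k (x + b) - k x\<bar>)" for b
  have d_le: "d b \<le> \<delta> * real N" if "b \<in> D" for b
    unfolding d_def by (rule order.trans[OF sum_mono inv[OF that]]) (auto simp: k_def min_def)
  have d_add: "d (b + c) \<le> d b + d c" for b c
  proof -
    have "d (b + c) \<le> (\<Sum>x\<in>Z. \<bar>k (x + c + b) - k (x + c)\<bar> + \<bar>k (x + c) - k x\<bar>)"
      unfolding d_def by (intro sum_mono) (simp add: add_ac)
    also have "(\<Sum>x\<in>Z. \<bar>k (x + c + b) - k (x + c)\<bar> + \<bar>k (x + c) - k x\<bar>) = d b + d c"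
    proof -
      have "periodic (\<lambda>x. \<bar>k (x + b) - k x\<bar>)"
        using periodic_shift[OF kper, of b] kper by (simp add: periodic_def)
      from sum_shift[OF this, of c] show ?thesis by (simp add: sum.distrib d_def)
    qed
    finally show ?thesis .
  qed
  have d_minus: "d (- b) = d b" for b
  proof -
    have "periodic (\<lambda>x. \<bar>k (x - b) - k x\<bar>)"
      using periodic_shift'[OF kper, of b] kper by (simp add: periodic_def)
    from sum_shift[OF this, of b] show ?thesis by (simp add: d_def abs_minus_commute)
  qed
  \<comment> \<open>The tangent line to the square at \<open>m\<close> lies below it and has
    nonnegative slope, so the lower bound for the mean of \<open>k\<close> can be inserted.\<close>
  have mean2: "m\<^sup>2 * real N \<le> (\<Sum>x\<in>Z. (k x)\<^sup>2)"
  proof -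
    have "2 * m * k x - m\<^sup>2 \<le> (k x)\<^sup>2" for x
      using sum_squares_bound[of m "k x"] by simp
    then have "(\<Sum>x\<in>Z. 2 * m * k x - m\<^sup>2) \<le> (\<Sum>x\<in>Z. (k x)\<^sup>2)" by (rule sum_mono)
    moreover have "(\<Sum>x\<in>Z. 2 * m * k x - m\<^sup>2) = 2 * m * (\<Sum>x\<in>Z. k x) - real N * m\<^sup>2"
      by (simp add: sum_subtractf sum_distrib_left)
    moreover have "2 * m * (\<Sum>x\<in>Z. k x) \<ge> 2 * m * (m * real N)"
      using m by (intro mult_left_mono) (auto simp: k_def)
    ultimately show ?thesis by (simp add: power2_eq_square algebra_simps)
  qed
  \<comment> \<open>Again by the tangent line at \<open>m\<close>: the difference to the cube
    factors as a square times a nonnegative term.\<close>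
  have mean3: "m ^ 3 * real N \<le> (\<Sum>x\<in>Z. (k x) ^ 3)"
  proof -
    have "3 * m\<^sup>2 * k x - 2 * m ^ 3 \<le> (k x) ^ 3" for x
    proof -
      have "(k x) ^ 3 - (3 * m\<^sup>2 * k x - 2 * m ^ 3) = (k x - m)\<^sup>2 * (k x + 2 * m)"
        by (simp add: power2_eq_square power3_eq_cube algebra_simps)
      also have "\<dots> \<ge> 0" using k m by (intro mult_nonneg_nonneg) auto
      finally show ?thesis by simp
    qed
    then have "(\<Sum>x\<in>Z. 3 * m\<^sup>2 * k x - 2 * m ^ 3) \<le> (\<Sum>x\<in>Z. (k x) ^ 3)" by (rule sum_mono)
    moreover have "(\<Sum>x\<in>Z. 3 * m\<^sup>2 * k x - 2 * m ^ 3) = 3 * m\<^sup>2 * (\<Sum>x\<in>Z. k x) - real N * (2 * m ^ 3)"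
      by (simp add: sum_subtractf sum_distrib_left)
    moreover have "3 * m\<^sup>2 * (\<Sum>x\<in>Z. k x) \<ge> 3 * m\<^sup>2 * (m * real N)"
      using m by (intro mult_left_mono) (auto simp: k_def)
    ultimately show ?thesis by (simp add: power2_eq_square power3_eq_cube algebra_simps)
  qed
  \<comment> \<open>The shift \<open>2 * b - 3 * c\<close> is composed of five shifts by elements of
    \<open>D\<close> or their negatives, each costing \<open>\<delta> * N\<close>.\<close>
  have two: "(\<Sum>x\<in>Z. k x * k (x + (2 * b - 3 * c))) \<ge> (m\<^sup>2 - 5 * \<delta>) * real N"
    if "b \<in> D" "c \<in> D" for b c
  proof -
    have "d (2 * b - 3 * c) \<le> d b + d b + (d c + d c + d c)"
      using d_add[of "b + b" "- (c + c + c)"] d_add[of b b] d_add[of "c + c" c] d_add[of c c]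
        d_minus[of "c + c + c"] by (simp add: algebra_simps)
    also have "\<dots> \<le> 5 * \<delta> * real N" using d_le[of b] d_le[of c] that by simp
    finally have "(\<Sum>x\<in>Z. \<bar>k (x + (2 * b - 3 * c)) - k x\<bar>) \<le> 5 * \<delta> * real N"
      unfolding d_def .
    moreover have "(\<Sum>x\<in>Z. (k x)\<^sup>2 - \<bar>k (x + (2 * b - 3 * c)) - k x\<bar>) \<le>
        (\<Sum>x\<in>Z. k x * k (x + (2 * b - 3 * c)))"
    proof (intro sum_mono)
      fix x
      let ?y = "k (x + (2 * b - 3 * c))"
      have "k x * (k x - ?y) \<le> k x * \<bar>?y - k x\<bar>" using k by (intro mult_left_mono) auto
      also have "\<dots> \<le> 1 * \<bar>?y - k x\<bar>" using k by (intro mult_right_mono) auto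
      finally show "(k x)\<^sup>2 - \<bar>?y - k x\<bar> \<le> k x * ?y"
        by (simp add: power2_eq_square algebra_simps)
    qed
    ultimately show ?thesis using mean2 by (simp add: sum_subtractf algebra_simps)
  qed
  have three: "(\<Sum>y\<in>Z. k y * k (y + b) * k (y + c)) \<ge> (m ^ 3 - 2 * \<delta>) * real N"
    if "b \<in> D" "c \<in> D" for b c
  proof -
    have "(\<Sum>x\<in>Z. (k x) ^ 3 - (\<bar>k (x + b) - k x\<bar> + \<bar>k (x + c) - k x\<bar>)) \<le>
        (\<Sum>x\<in>Z. k x * k (x + b) * k (x + c))"
    proof (intro sum_mono)
      fix x
      let ?y = "k (x + b)" and ?z = "k (x + c)"
      have "k x ^ 3 - k x * ?y * ?z = (k x * k x) * (k x - ?y) + (k x * ?y) * (k x - ?z)"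
        by (simp add: power3_eq_cube algebra_simps)
      also have "\<dots> \<le> (k x * k x) * \<bar>?y - k x\<bar> + (k x * ?y) * \<bar>?z - k x\<bar>"
        using k by (intro add_mono mult_left_mono) auto
      also have "\<dots> \<le> 1 * \<bar>?y - k x\<bar> + 1 * \<bar>?z - k x\<bar>"
        using k by (intro add_mono mult_right_mono mult_le_one) auto
      finally show "k x ^ 3 - (\<bar>?y - k x\<bar> + \<bar>?z - k x\<bar>) \<le> k x * ?y * ?z" by simp
    qed
    then show ?thesis using mean3 d_le[OF that(1)] d_le[OF that(2)]
      by (simp add: sum_subtractf sum.distrib algebra_simps d_def)
  qed
  \<comment> \<open>With \<open>x3 = y + b\<close> and \<open>x5 = y + c\<close> the multiples of
    \<open>y\<close> cancel in \<open>x4\<close>, which becomes \<open>x + (2 * b - 3 * c)\<close>.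
    For fixed \<open>b\<close> and \<open>c\<close> the weighted count is therefore a product of a
    sum over \<open>x\<close> and a sum over \<open>y\<close>.\<close>
  define G where "G b c = (\<Sum>x\<in>Z. h x * h (x + (2 * b - 3 * c))) * (\<Sum>y\<in>Z. h y * h (y + b) * h (y + c))" for b c
  have G0: "G b c \<ge> 0" for b c by (simp add: G_def sum_nonneg nn)
  have G: "G b c \<ge> (m\<^sup>2 - 5 * \<delta>) * real N * ((m ^ 3 - 2 * \<delta>) * real N)" if "b \<in> D" "c \<in> D" for b c
  proof -
    have "(m\<^sup>2 - 5 * \<delta>) * real N \<le> (\<Sum>x\<in>Z. h x * h (x + (2 * b - 3 * c)))"
      by (rule order.trans[OF two[OF that]]) (intro sum_mono mult_mono k nn)
    moreover have "(m ^ 3 - 2 * \<delta>) * real N \<le> (\<Sum>y\<in>Z. h y * h (y + b) * h (y + c))"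
      by (rule order.trans[OF three[OF that]]) (intro sum_mono mult_mono mult_nonneg_nonneg k nn)
    ultimately show ?thesis unfolding G_def
      using \<delta> by (intro mult_mono mult_nonneg_nonneg sum_nonneg nn) auto
  qed
  have "sol_sum h = (\<Sum>x\<in>Z. \<Sum>y\<in>Z. \<Sum>b\<in>Z. \<Sum>c\<in>Z.
     h x * h y * h (y + b) * h (y + c) * h (x + y + 2 * (y + b) - 3 * (y + c)))"
    unfolding sol_sum_def
  proof (rule sum.cong[OF refl], rule sum.cong[OF refl])
    fix x y
    have p5: "periodic (\<lambda>w. h x * h y * h z * h w * h (x + y + 2 * z - 3 * w))" for z
      using per periodic_affine[OF per, of "- 3" "x + y + 2 * z"]
      by (simp add: periodic_def algebra_simps)
    have p3: "periodic (\<lambda>z. \<Sum>w\<in>Z. h x * h y * h z * h w * h (x + y + 2 * z - 3 * w))"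
    proof (rule periodic_sum)
      fix w
      show "periodic (\<lambda>z. h x * h y * h z * h w * h (x + y + 2 * z - 3 * w))"
        using per periodic_affine[OF per, of 2 "x + y - 3 * w"]
        by (simp add: periodic_def algebra_simps)
    qed
    show "(\<Sum>z\<in>Z. \<Sum>w\<in>Z. h x * h y * h z * h w * h (x + y + 2 * z - 3 * w)) =
      (\<Sum>b\<in>Z. \<Sum>c\<in>Z. h x * h y * h (y + b) * h (y + c) * h (x + y + 2 * (y + b) - 3 * (y + c)))"
      unfolding sum_shift'[OF p5] sum_shift'[OF p3] ..
  qed
  also have "\<dots> = (\<Sum>x\<in>Z. \<Sum>y\<in>Z. \<Sum>b\<in>Z. \<Sum>c\<in>Z.
     (h x * h (x + (2 * b - 3 * c))) * (h y * h (y + b) * h (y + c)))"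
    by (intro sum.cong refl) (simp add: algebra_simps)
  also have "\<dots> = (\<Sum>x\<in>Z. \<Sum>b\<in>Z. \<Sum>y\<in>Z. \<Sum>c\<in>Z.
     (h x * h (x + (2 * b - 3 * c))) * (h y * h (y + b) * h (y + c)))"
    by (rule sum.cong[OF refl], rule sum.swap)
  also have "\<dots> = (\<Sum>b\<in>Z. \<Sum>x\<in>Z. \<Sum>y\<in>Z. \<Sum>c\<in>Z.
     (h x * h (x + (2 * b - 3 * c))) * (h y * h (y + b) * h (y + c)))"
    by (rule sum.swap)
  also have "\<dots> = (\<Sum>b\<in>Z. \<Sum>x\<in>Z. \<Sum>c\<in>Z. \<Sum>y\<in>Z.
     (h x * h (x + (2 * b - 3 * c))) * (h y * h (y + b) * h (y + c)))"
    by (rule sum.cong[OF refl], rule sum.cong[OF refl], rule sum.swap)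
  also have "\<dots> = (\<Sum>b\<in>Z. \<Sum>c\<in>Z. \<Sum>x\<in>Z. \<Sum>y\<in>Z.
     (h x * h (x + (2 * b - 3 * c))) * (h y * h (y + b) * h (y + c)))"
    by (rule sum.cong[OF refl], rule sum.swap)
  also have "\<dots> = (\<Sum>b\<in>Z. \<Sum>c\<in>Z. G b c)"
    unfolding G_def sum_product ..
  finally have sol: "sol_sum h = (\<Sum>b\<in>Z. \<Sum>c\<in>Z. G b c)" .
  have "(real (card D))\<^sup>2 * ((m\<^sup>2 - 5 * \<delta>) * real N * ((m ^ 3 - 2 * \<delta>) * real N)) =
    (\<Sum>b\<in>D. \<Sum>c\<in>D. (m\<^sup>2 - 5 * \<delta>) * real N * ((m ^ 3 - 2 * \<delta>) * real N))"
    by (simp add: power2_eq_square)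
  also have "\<dots> \<le> (\<Sum>b\<in>D. \<Sum>c\<in>D. G b c)" by (intro sum_mono G)
  also have "\<dots> \<le> (\<Sum>b\<in>D. \<Sum>c\<in>Z. G b c)"
    using D by (intro sum_mono sum_mono2) (auto simp: G0)
  also have "\<dots> \<le> (\<Sum>b\<in>Z. \<Sum>c\<in>Z. G b c)"
    using D by (intro sum_mono2) (auto simp: G0 sum_nonneg)
  finally show ?thesis using sol by simp
qed

end

section \<open>Large spectra and Bohr sets\<close>

lemma sum_square_le:
  fixes f :: "'a \<Rightarrow> real"
  shows "(\<Sum>x\<in>X. f x)\<^sup>2 \<le> real (card X) * (\<Sum>x\<in>X. (f x)\<^sup>2)"
proof -
  have "(\<Sum>x\<in>X. f x)\<^sup>2 = (\<Sum>x\<in>X. \<Sum>y\<in>X. f x * f y)"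
    by (simp add: power2_eq_square sum_product)
  also have "\<dots> \<le> (\<Sum>x\<in>X. \<Sum>y\<in>X. ((f x)\<^sup>2 + (f y)\<^sup>2) / 2)"
  proof (intro sum_mono)
    fix x y show "f x * f y \<le> ((f x)\<^sup>2 + (f y)\<^sup>2) / 2"
      using sum_squares_bound[of "f x" "f y"] by simp
  qed
  also have "\<dots> = real (card X) * (\<Sum>x\<in>X. (f x)\<^sup>2)"
    by (simp add: sum_divide_distrib[symmetric] sum.distrib sum_distrib_left[symmetric])
  finally show ?thesis .
qed

text \<open>Number of cells of a square grid of mesh \<open>1 / K\<close>, with \<open>K\<close> the
  ceiling of \<open>2 / \<eta>\<close>: a coordinate of a point on the unit circle, multiplied by
  \<open>K\<close> and rounded down, lies in \<open>{- K..K}\<close>.\<close>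

definition cells :: "real \<Rightarrow> nat" where
  "cells \<eta> = (2 * nat \<lceil>2 / \<eta>\<rceil> + 1)\<^sup>2"

text \<open>Points in one grid cell differ by at most \<open>\<eta> / 2\<close> in each coordinate,
  hence by at most \<open>\<eta>\<close> in modulus, and some cell holds at least the average number
  of points.\<close>

lemma circle_pigeonhole:
  fixes f :: "'a \<Rightarrow> complex"
  assumes "\<eta> > 0" "finite X" "\<And>x. x \<in> X \<Longrightarrow> cmod (f x) = 1"
  shows "\<exists>Y\<subseteq>X. card X \<le> cells \<eta> * card Y \<and> (\<forall>x\<in>Y. \<forall>y\<in>Y. cmod (f x - f y) \<le> \<eta>)"
proof -
  define K where "K = \<lceil>2 / \<eta>\<rceil>"
  have K: "real_of_int K \<ge> 2 / \<eta>" "K > 0"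
    using assms(1) by (simp_all add: K_def)
  define \<phi> where "\<phi> x = (\<lfloor>K * Re (f x)\<rfloor>, \<lfloor>K * Im (f x)\<rfloor>)" for x
  let ?C = "{- K..K} \<times> {- K..K}"
  have bd: "\<lfloor>K * t\<rfloor> \<in> {- K..K}" if "\<bar>t\<bar> \<le> 1" for t :: real
  proof -
    have "real_of_int K * t \<le> real_of_int K * 1" "real_of_int K * (- 1) \<le> real_of_int K * t"
      using that K(2) by (intro mult_left_mono; simp)+
    then show ?thesis by (simp add: floor_le_iff le_floor_iff)
  qed
  have "\<phi> \<in> X \<rightarrow> ?C"
  proof
    fix x assume "x \<in> X"
    then have "\<bar>Re (f x)\<bar> \<le> 1" "\<bar>Im (f x)\<bar> \<le> 1"
      using abs_Re_le_cmod[of "f x"] abs_Im_le_cmod[of "f x"] assms(3) by auto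
    then show "\<phi> x \<in> ?C" unfolding \<phi>_def using bd by blast
  qed
  then obtain c where c: "card (\<phi> -` {c} \<inter> X) * card ?C \<ge> card X"
    using pigeonhole_card[of \<phi> X ?C] assms(2) K(2) by auto
  have "card ?C = cells \<eta>"
    using K(2) by (simp add: cells_def card_cartesian_product K_def[symmetric] power2_eq_square
        nat_add_distrib nat_mult_distrib)
  moreover have "cmod (f x - f y) \<le> \<eta>" if "x \<in> \<phi> -` {c} \<inter> X" "y \<in> \<phi> -` {c} \<inter> X" for x y
  proof -
    have near: "\<bar>s - t\<bar> \<le> \<eta> / 2" if "\<lfloor>K * s\<rfloor> = \<lfloor>K * t\<rfloor>" for s t :: real
    proof -
      have "\<bar>real_of_int K * s - real_of_int K * t\<bar> \<le> 1"
        using that by linarith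
      then have "real_of_int K * \<bar>s - t\<bar> \<le> 1"
        using K(2) by (simp add: abs_mult right_diff_distrib[symmetric])
      moreover have "2 / \<eta> * \<bar>s - t\<bar> \<le> real_of_int K * \<bar>s - t\<bar>"
        using K(1) by (intro mult_right_mono) auto
      ultimately have "2 / \<eta> * \<bar>s - t\<bar> \<le> 1" by linarith
      then show ?thesis using assms(1) by (simp add: field_simps)
    qed
    have "\<phi> x = \<phi> y" using that by simp
    then have "\<bar>Re (f x) - Re (f y)\<bar> \<le> \<eta> / 2" "\<bar>Im (f x) - Im (f y)\<bar> \<le> \<eta> / 2"
      by (intro near; simp add: \<phi>_def)+
    then have "\<bar>Re (f x - f y)\<bar> \<le> \<eta> / 2" "\<bar>Im (f x - f y)\<bar> \<le> \<eta> / 2" by simp_all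
    then show ?thesis using cmod_le[of "f x - f y"] by linarith
  qed
  ultimately show ?thesis using c by (intro exI[of _ "\<phi> -` {c} \<inter> X"]) (auto simp: mult.commute)
qed

text \<open>The pigeonhole on one circle is applied for each \<open>r\<close> in turn to the set
  that has survived so far, losing a factor \<open>cells \<eta>\<close> each time.\<close>

lemma torus_pigeonhole:
  fixes f :: "'b \<Rightarrow> 'a \<Rightarrow> complex"
  assumes "\<eta> > 0" "finite R" "finite X" "\<And>r x. cmod (f r x) = 1"
  shows "\<exists>Y\<subseteq>X. card X \<le> cells \<eta> ^ card R * card Y \<and>
    (\<forall>r\<in>R. \<forall>x\<in>Y. \<forall>y\<in>Y. cmod (f r x - f r y) \<le> \<eta>)"
  using assms(2)
proof (induction R rule: finite_induct)
  case empty
  then show ?case by auto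
next
  case (insert r R)
  then obtain Y where Y: "Y \<subseteq> X" "card X \<le> cells \<eta> ^ card R * card Y"
    "\<forall>r\<in>R. \<forall>x\<in>Y. \<forall>y\<in>Y. cmod (f r x - f r y) \<le> \<eta>" by auto
  have "finite Y" using Y(1) assms(3) finite_subset by blast
  then obtain Y' where Y': "Y' \<subseteq> Y" "card Y \<le> cells \<eta> * card Y'"
    "\<forall>x\<in>Y'. \<forall>y\<in>Y'. cmod (f r x - f r y) \<le> \<eta>"
    using circle_pigeonhole[OF assms(1), of Y "f r"] assms(4) by blast
  have "card X \<le> cells \<eta> ^ card R * (cells \<eta> * card Y')"
    using Y(2) Y'(2) by (meson le_trans mult_le_mono2)
  then have "card X \<le> cells \<eta> ^ card (insert r R) * card Y'"
    using insert by (simp add: mult_ac)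
  then show ?case using Y Y' by (intro exI[of _ Y']) blast
qed

text \<open>The exponent bounds the number of large frequencies of a Sidon set, see \<open>card_spec\<close>.\<close>

definition bohr_density :: "real \<Rightarrow> real" where
  "bohr_density \<eta> = 1 / real (cells \<eta>) ^ nat \<lfloor>4 / \<eta> ^ 4\<rfloor>"

lemma cells_pos: "cells \<eta> > 0"
  by (simp add: cells_def)

lemma bohr_density_bounds: "0 < bohr_density \<eta>" "bohr_density \<eta> \<le> 1"
proof -
  have "1 \<le> real (cells \<eta>)" using cells_pos[of \<eta>] by simp
  then show "0 < bohr_density \<eta>" "bohr_density \<eta> \<le> 1"
    by (simp_all add: bohr_density_def)
qed

section \<open>Large spectrum and Bohr set of a Sidon set\<close>

context residue_fourier
begin

definition spec :: "int set \<Rightarrow> real \<Rightarrow> int set" where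
  "spec A \<eta> = {r\<in>Z. \<eta> * sqrt (real N) \<le> cmod (dft (ind A) r)}"

text \<open>The same \<open>\<eta>\<close> serves as the threshold for large frequencies and as the
  width, so that a scale is described by one parameter.\<close>

definition bohr :: "int set \<Rightarrow> real \<Rightarrow> int set" where
  "bohr A \<eta> = {x\<in>Z. \<forall>r\<in>spec A \<eta>. cmod (e (r * x) - 1) \<le> \<eta>}"

lemma spec_subset: "spec A \<eta> \<subseteq> Z" and bohr_subset: "bohr A \<eta> \<subseteq> Z"
  by (auto simp: spec_def bohr_def)

lemma finite_spec: "finite (spec A \<eta>)"
  using spec_subset finite_Z by (rule finite_subset)

lemma spec_antimono: "\<eta>' \<le> \<eta> \<Longrightarrow> spec A \<eta> \<subseteq> spec A \<eta>'"
  unfolding spec_def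
  by (auto intro: order.trans[OF mult_right_mono[of \<eta>' \<eta> "sqrt (real N)"]])

text \<open>Each member of the spectrum contributes at least \<open>\<eta> ^ 4 * N\<^sup>2\<close>
  to the fourth moment, which is at most \<open>4 * N\<^sup>2\<close>.\<close>

lemma card_spec:
  assumes "sidon A" "\<eta> > 0"
  shows "real (card (spec A \<eta>)) \<le> 4 / \<eta> ^ 4"
proof -
  have sq: "sqrt (real N) ^ 4 = (real N)\<^sup>2"
    by (simp add: power4_eq_xxxx power2_eq_square)
  have "real (card (spec A \<eta>)) * (\<eta> ^ 4 * (real N)\<^sup>2) = (\<Sum>r\<in>spec A \<eta>. (\<eta> * sqrt (real N)) ^ 4)"
    by (simp add: power_mult_distrib sq)
  also have "\<dots> \<le> (\<Sum>r\<in>spec A \<eta>. cmod (dft (ind A) r) ^ 4)"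
    using assms(2) by (intro sum_mono power_mono) (auto simp: spec_def)
  also have "\<dots> \<le> (\<Sum>r\<in>Z. cmod (dft (ind A) r) ^ 4)"
    by (intro sum_mono2 spec_subset) auto
  also have "\<dots> \<le> 2 * real N * (real (card A))\<^sup>2"
    by (rule sidon_fourth_moment[OF assms(1)])
  also have "\<dots> \<le> 2 * real N * (2 * real N)"
    by (intro mult_left_mono sidon_card_square[OF assms(1)]) simp
  finally have "(real (card (spec A \<eta>)) * \<eta> ^ 4) * (real N)\<^sup>2 \<le> 4 * (real N)\<^sup>2"
    by (simp add: power2_eq_square mult_ac)
  then have "real (card (spec A \<eta>)) * \<eta> ^ 4 \<le> 4"
    using N_pos by simp
  then show ?thesis using assms(2) by (simp add: field_simps)
qed

text \<open>Pigeonholing gives a large set on which the characters of the spectrum nearly agree;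
  translating it by one of its own elements places it inside the Bohr set.\<close>

lemma card_bohr:
  assumes "sidon A" "\<eta> > 0"
  shows "bohr_density \<eta> * real N \<le> real (card (bohr A \<eta>))"
proof -
  let ?R = "spec A \<eta>"
  obtain Y where Y: "Y \<subseteq> Z" "N \<le> cells \<eta> ^ card ?R * card Y"
    "\<And>r x y. r \<in> ?R \<Longrightarrow> x \<in> Y \<Longrightarrow> y \<in> Y \<Longrightarrow> cmod (e (r * x) - e (r * y)) \<le> \<eta>"
    using torus_pigeonhole[OF assms(2) finite_spec finite_Z, of "\<lambda>r x. e (r * x)" A \<eta>]
    by (simp only: norm_e card_Z) blast
  have "Y \<noteq> {}" using Y(2) N_pos by auto
  then obtain z where z: "z \<in> Y" by auto
  let ?f = "\<lambda>y. (y - z) mod int N"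
  have "inj_on ?f Y"
  proof (rule inj_onI)
    fix x y assume xy: "x \<in> Y" "y \<in> Y" "?f x = ?f y"
    then have "x mod int N = y mod int N" by (simp only: mod_eq_dvd_iff) simp
    then show "x = y" using xy Y(1) by (simp add: subset_iff)
  qed
  moreover have "?f ` Y \<subseteq> bohr A \<eta>"
  proof
    fix w assume "w \<in> ?f ` Y"
    then obtain y where y: "y \<in> Y" "w = ?f y" by auto
    have "cmod (e (r * w) - 1) \<le> \<eta>" if "r \<in> ?R" for r
    proof -
      have "e (r * w) = e (r * (y - z))"
        unfolding y(2) by (rule e_cong) (simp add: mod_mult_right_eq)
      moreover have "e (r * z) * (e (r * (y - z)) - 1) = e (r * y) - e (r * z)"
        by (simp add: right_diff_distrib e_add[symmetric])
      then have "cmod (e (r * (y - z)) - 1) = cmod (e (r * y) - e (r * z))"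
        by (metis mult_1 norm_e norm_mult)
      ultimately show ?thesis using Y(3)[OF that y(1) z] by simp
    qed
    then show "w \<in> bohr A \<eta>" by (simp add: bohr_def y(2))
  qed
  ultimately have le: "card Y \<le> card (bohr A \<eta>)"
    using finite_subset[OF bohr_subset finite_Z] by (metis card_image card_mono)
  have "int (card ?R) \<le> \<lfloor>4 / \<eta> ^ 4\<rfloor>"
    using card_spec[OF assms] by (simp add: le_floor_iff)
  then have cR: "card ?R \<le> nat \<lfloor>4 / \<eta> ^ 4\<rfloor>" by simp
  have "N \<le> cells \<eta> ^ nat \<lfloor>4 / \<eta> ^ 4\<rfloor> * card (bohr A \<eta>)"
    by (rule order.trans[OF Y(2)])
      (use cells_pos[of \<eta>] in \<open>intro mult_le_mono le power_increasing cR, simp\<close>)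
  then have "real N \<le> real (cells \<eta>) ^ nat \<lfloor>4 / \<eta> ^ 4\<rfloor> * real (card (bohr A \<eta>))"
    by (metis of_nat_le_iff of_nat_mult of_nat_power)
  then show ?thesis using cells_pos[of \<eta>] by (simp add: bohr_density_def field_simps)
qed

section \<open>Energy of the large frequencies and almost invariance\<close>

lemma bhat_bohr: "r \<in> spec A \<eta> \<Longrightarrow> bohr A \<eta> \<noteq> {} \<Longrightarrow> cmod (bhat (bohr A \<eta>) r - 1) \<le> \<eta>"
  by (intro bhat_near_1 bohr_subset) (auto simp: bohr_def)

lemma norm_dft_smooth_square:
  "(cmod (dft (smooth A B) r))\<^sup>2 = real N * ((cmod (dft (ind A) r))\<^sup>2 * (cmod (bhat B r))\<^sup>2)"
  by (simp add: dft_smooth norm_mult power_mult_distrib)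

lemma smooth_energy:
  assumes "sidon A" "B \<subseteq> Z" "B \<noteq> {}" "card A \<le> card B"
  shows "(\<Sum>x\<in>Z. (smooth A B x)\<^sup>2) \<le> 2 * real N"
proof -
  have "real (card A) / real (card B) \<le> 1" using assms(4) by (simp add: divide_le_eq)
  then have "real N * (1 + real (card A) / real (card B)) \<le> real N * 2"
    by (intro mult_left_mono) auto
  then show ?thesis using sum_smooth_square[OF assms(1-3)] by simp
qed

text \<open>On the spectrum \<open>bhat\<close> has modulus at least 1/2, so averaging loses at most
  a factor 4 in the squares there, and the energy of the average bounds the rest. The outcome
  depends on neither \<open>N\<close> nor \<open>\<eta>\<close>, as the pigeonhole over scales
  requires.\<close>

lemma spec_mass:
  assumes "sidon A" "\<eta> \<le> 1 / 2" "bohr A \<eta> \<noteq> {}" "card A \<le> card (bohr A \<eta>)"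
  shows "(\<Sum>r\<in>spec A \<eta>. (cmod (dft (ind A) r))\<^sup>2) \<le> 8 * real N"
proof -
  let ?B = "bohr A \<eta>" and ?S = "\<lambda>r. cmod (dft (ind A) r)"
  have "(\<Sum>r\<in>spec A \<eta>. (?S r)\<^sup>2) \<le> (\<Sum>r\<in>spec A \<eta>. 4 * ((?S r)\<^sup>2 * (cmod (bhat ?B r))\<^sup>2))"
  proof (rule sum_mono)
    fix r assume "r \<in> spec A \<eta>"
    then have "cmod (bhat ?B r - 1) \<le> 1 / 2" using bhat_bohr assms(2,3) by fastforce
    then have "1 / 2 \<le> cmod (bhat ?B r)"
      using norm_triangle_ineq2[of 1 "bhat ?B r"] by (simp add: norm_minus_commute)
    then have "(1 / 2)\<^sup>2 \<le> (cmod (bhat ?B r))\<^sup>2" by (intro power_mono) auto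
    then have "(?S r)\<^sup>2 * 1 \<le> (?S r)\<^sup>2 * (4 * (cmod (bhat ?B r))\<^sup>2)"
      by (intro mult_left_mono) (auto simp: power2_eq_square)
    then show "(?S r)\<^sup>2 \<le> 4 * ((?S r)\<^sup>2 * (cmod (bhat ?B r))\<^sup>2)" by simp
  qed
  also have "\<dots> \<le> (\<Sum>r\<in>Z. 4 * ((?S r)\<^sup>2 * (cmod (bhat ?B r))\<^sup>2))"
    by (intro sum_mono2 spec_subset) auto
  finally have "real N * (\<Sum>r\<in>spec A \<eta>. (?S r)\<^sup>2) \<le>
      real N * (\<Sum>r\<in>Z. 4 * ((?S r)\<^sup>2 * (cmod (bhat ?B r))\<^sup>2))"
    by (intro mult_left_mono) auto
  also have "\<dots> = 4 * (\<Sum>r\<in>Z. (cmod (dft (smooth A ?B) r))\<^sup>2)"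
    unfolding norm_dft_smooth_square by (simp add: sum_distrib_left mult_ac)
  also have "\<dots> = 4 * (real N * (\<Sum>x\<in>Z. (smooth A ?B x)\<^sup>2))"
    by (simp only: parseval[OF periodic_smooth])
  also have "\<dots> \<le> 4 * (real N * (2 * real N))"
    by (intro mult_left_mono smooth_energy assms bohr_subset) auto
  finally have "real N * (\<Sum>r\<in>spec A \<eta>. (?S r)\<^sup>2) \<le> real N * (8 * real N)" by simp
  then show ?thesis using N_pos by simp
qed

text \<open>Translation by \<open>b\<close> and subtraction multiply the Fourier coefficients by
  \<open>e (- (r * b)) - 1\<close>. This is small on the coarse spectrum because \<open>b\<close>
  lies in its Bohr set. Between the two spectra the mass is small by assumption. Beyond the fine
  spectrum the coefficients of \<open>A\<close> are small, and Parseval bounds the squares of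
  \<open>bhat\<close> by \<open>1 / \<mu>\<close>. Cauchy-Schwarz passes from the second moment to
  the first.\<close>

lemma smooth_almost_invariant:
  assumes A: "sidon A" and \<eta>: "\<eta>0 \<le> 1 / 2" "\<eta>2 > 0" "\<eta>2 \<le> \<eta>0"
    and D: "card A \<le> card (bohr A \<eta>0)" "b \<in> bohr A \<eta>0"
    and B: "B \<subseteq> Z" "B \<noteq> {}" "\<mu> * real N \<le> real (card B)" "\<mu> > 0"
    and mass: "(\<Sum>r\<in>spec A \<eta>2 - spec A \<eta>0. (cmod (dft (ind A) r))\<^sup>2) \<le> \<kappa> * real N"
    and small: "8 * \<eta>0\<^sup>2 + 4 * \<kappa> + 4 * \<eta>2\<^sup>2 / \<mu> \<le> \<delta>\<^sup>2" "\<delta> \<ge> 0"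
  shows "(\<Sum>x\<in>Z. \<bar>smooth A B (x + b) - smooth A B x\<bar>) \<le> \<delta> * real N"
proof -
  let ?h = "smooth A B" and ?S = "\<lambda>r. cmod (dft (ind A) r)"
  define g where "g x = ?h (x + b) - ?h x" for x
  define w where "w r = (?S r)\<^sup>2 * (cmod (bhat B r))\<^sup>2 * (cmod (e (- (r * b)) - 1))\<^sup>2" for r
  have N0: "real N > 0" using N_pos by simp
  have gper: "periodic g"
    unfolding g_def using periodic_shift[OF periodic_smooth] periodic_smooth
    by (simp add: periodic_def)
  have "dft g r = dft ?h r * (e (- (r * b)) - 1)" for r
  proof -
    have "dft g r = dft (\<lambda>x. ?h (x + b)) r - dft ?h r"
      by (simp add: dft_def g_def left_diff_distrib sum_subtractf)
    then show ?thesis by (simp add: dft_shift[OF periodic_smooth] algebra_simps)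
  qed
  then have gw: "(cmod (dft g r))\<^sup>2 = real N * w r" for r
    by (simp add: norm_mult power_mult_distrib norm_dft_smooth_square w_def)
  have b1: "(cmod (bhat B r))\<^sup>2 \<le> 1" for r
    using norm_bhat[OF B(1), of r] by (simp add: power_le_one)
  have e2: "(cmod (e k - 1))\<^sup>2 \<le> 4" for k
  proof -
    have "cmod (e k - 1) \<le> 2" using norm_triangle_ineq4[of "e k" 1] by simp
    then have "(cmod (e k - 1))\<^sup>2 \<le> 2\<^sup>2" by (intro power_mono) auto
    then show ?thesis by simp
  qed
  have w0: "(\<Sum>r\<in>spec A \<eta>0. w r) \<le> 8 * \<eta>0\<^sup>2 * real N"
  proof -
    have "(\<Sum>r\<in>spec A \<eta>0. w r) \<le> (\<Sum>r\<in>spec A \<eta>0. (?S r)\<^sup>2 * 1 * \<eta>0\<^sup>2)"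
      unfolding w_def
    proof (intro sum_mono mult_mono b1 order.refl)
      fix r assume "r \<in> spec A \<eta>0"
      then have "cmod (e (r * b) - 1) \<le> \<eta>0" using D(2) by (auto simp: bohr_def)
      moreover have "cmod (e (- (r * b)) - 1) = cmod (e (r * b) - 1)"
        by (metis cnj_e complex_cnj_diff complex_cnj_one complex_mod_cnj)
      ultimately show "(cmod (e (- (r * b)) - 1))\<^sup>2 \<le> \<eta>0\<^sup>2" by (intro power_mono) auto
    qed auto
    also have "\<dots> = \<eta>0\<^sup>2 * (\<Sum>r\<in>spec A \<eta>0. (?S r)\<^sup>2)"
      by (simp add: sum_distrib_left mult.commute)
    also have "\<dots> \<le> \<eta>0\<^sup>2 * (8 * real N)"
      using D by (intro mult_left_mono spec_mass A \<eta>) auto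
    finally show ?thesis by simp
  qed
  have w1: "(\<Sum>r\<in>spec A \<eta>2 - spec A \<eta>0. w r) \<le> 4 * \<kappa> * real N"
  proof -
    have "(\<Sum>r\<in>spec A \<eta>2 - spec A \<eta>0. w r) \<le> (\<Sum>r\<in>spec A \<eta>2 - spec A \<eta>0. (?S r)\<^sup>2 * 1 * 4)"
      unfolding w_def by (intro sum_mono mult_mono b1 e2) auto
    also have "\<dots> = 4 * (\<Sum>r\<in>spec A \<eta>2 - spec A \<eta>0. (?S r)\<^sup>2)"
      by (simp add: sum_distrib_left mult.commute)
    finally show ?thesis using mass by simp
  qed
  have w2: "(\<Sum>r\<in>Z - spec A \<eta>2. w r) \<le> 4 * \<eta>2\<^sup>2 / \<mu> * real N"
  proof -
    have "(\<Sum>r\<in>Z - spec A \<eta>2. w r) \<le> (\<Sum>r\<in>Z - spec A \<eta>2. \<eta>2\<^sup>2 * real N * (cmod (bhat B r))\<^sup>2 * 4)"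
      unfolding w_def
    proof (intro sum_mono mult_mono e2 order.refl)
      fix r assume "r \<in> Z - spec A \<eta>2"
      then have "?S r \<le> \<eta>2 * sqrt (real N)" by (auto simp: spec_def)
      then have "(?S r)\<^sup>2 \<le> (\<eta>2 * sqrt (real N))\<^sup>2" by (intro power_mono) auto
      then show "(?S r)\<^sup>2 \<le> \<eta>2\<^sup>2 * real N" by (simp add: power_mult_distrib)
    qed auto
    also have "\<dots> = 4 * \<eta>2\<^sup>2 * real N * (\<Sum>r\<in>Z - spec A \<eta>2. (cmod (bhat B r))\<^sup>2)"
      by (simp add: sum_distrib_left mult_ac)
    also have "\<dots> \<le> 4 * \<eta>2\<^sup>2 * real N * (\<Sum>r\<in>Z. (cmod (bhat B r))\<^sup>2)"
      by (intro mult_left_mono sum_mono2) auto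
    also have "\<dots> = 4 * \<eta>2\<^sup>2 * real N * (real N / real (card B))"
      by (simp only: sum_bhat_square[OF B(1,2)])
    also have "real N / real (card B) \<le> 1 / \<mu>"
    proof -
      have "real (card B) > 0" using B N0 by (meson less_le_trans mult_pos_pos)
      then show ?thesis using B(3,4) by (simp add: field_simps)
    qed
    finally show ?thesis by (simp add: mult_left_mono)
  qed
  have "(\<Sum>r\<in>Z. w r) = (\<Sum>r\<in>spec A \<eta>2. w r) + (\<Sum>r\<in>Z - spec A \<eta>2. w r)"
    using sum.subset_diff[OF spec_subset[of A \<eta>2] finite_Z, of w] by simp
  also have "(\<Sum>r\<in>spec A \<eta>2. w r) = (\<Sum>r\<in>spec A \<eta>0. w r) + (\<Sum>r\<in>spec A \<eta>2 - spec A \<eta>0. w r)"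
    using sum.subset_diff[OF spec_antimono[OF \<eta>(3)] finite_spec, of w A] by simp
  finally have "(\<Sum>r\<in>Z. w r) \<le> (8 * \<eta>0\<^sup>2 + 4 * \<kappa> + 4 * \<eta>2\<^sup>2 / \<mu>) * real N"
    using w0 w1 w2 by (simp add: distrib_right)
  also have "\<dots> \<le> \<delta>\<^sup>2 * real N" by (intro mult_right_mono small) simp
  finally have W: "(\<Sum>r\<in>Z. w r) \<le> \<delta>\<^sup>2 * real N" .
  have "(\<Sum>x\<in>Z. \<bar>g x\<bar>)\<^sup>2 \<le> real N * (\<Sum>x\<in>Z. (g x)\<^sup>2)"
    using sum_square_le[of "\<lambda>x. \<bar>g x\<bar>" Z] by simp
  also have "\<dots> = real N * (\<Sum>r\<in>Z. w r)"
    using parseval[OF gper] by (simp add: gw sum_distrib_left)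
  also have "\<dots> \<le> real N * (\<delta>\<^sup>2 * real N)" by (intro mult_left_mono W) simp
  also have "\<dots> = (\<delta> * real N)\<^sup>2" by (simp add: power2_eq_square)
  finally show ?thesis
    unfolding g_def by (rule power2_le_imp_le) (use small(2) in simp)
qed

end

section \<open>The choice of scales\<close>

text \<open>The gaps span two steps because three consecutive scales are used together. The
  telescoping sum then leaves two terms at either end, whence \<open>2 * C\<close>.\<close>

lemma pigeonhole_gap:
  fixes f :: "nat \<Rightarrow> real"
  assumes "\<And>i. i \<le> Suc K \<Longrightarrow> 0 \<le> f i \<and> f i \<le> C" "2 * C < \<kappa> * real K"
  shows "\<exists>i<K. f (i + 2) - f i \<le> \<kappa>"
proof (rule ccontr)
  assume "\<not> ?thesis"
  then have "(\<Sum>i<K. \<kappa>) \<le> (\<Sum>i<K. f (i + 2) - f i)"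
    by (intro sum_mono) (auto simp: not_le less_imp_le)
  moreover have "(\<Sum>i<K. f (i + 2) - f i) = f (Suc K) + f K - f 1 - f 0"
    by (induction K) (simp_all add: numeral_2_eq_2)
  moreover have "f (Suc K) \<le> C" "f K \<le> C" "f 0 \<ge> 0" "f 1 \<ge> 0" using assms(1) by auto
  ultimately show False using assms(2) by (simp add: mult.commute)
qed

section \<open>Lower bound at a good scale against the count of trivial solutions\<close>

context residue_fourier
begin

text \<open>The quadratic \<open>\<alpha> * h - \<alpha>\<^sup>2 / 4 * h\<^sup>2\<close> lies below
  both \<open>h\<close> and 1. Its mean is bounded using the first moment from below and the second
  from above, which leaves \<open>\<alpha>\<^sup>2 - \<alpha>\<^sup>2 / 2\<close>.\<close>

lemma sum_min_smooth:
  assumes A: "sidon A" and B: "B \<subseteq> Z" "B \<noteq> {}" "card A \<le> card B"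
    and \<alpha>: "0 \<le> \<alpha>" "\<alpha> \<le> 1" "\<alpha> * sqrt (real N) \<le> real (card A)"
  shows "\<alpha>\<^sup>2 / 2 * real N \<le> (\<Sum>x\<in>Z. min (smooth A B x) 1)"
proof -
  let ?h = "smooth A B"
  have pt: "\<alpha> * ?h x - \<alpha>\<^sup>2 / 4 * (?h x)\<^sup>2 \<le> min (?h x) 1" for x
  proof -
    have "\<alpha> * ?h x \<le> 1 * ?h x" using \<alpha> by (intro mult_right_mono smooth_nonneg)
    moreover have "0 \<le> \<alpha>\<^sup>2 / 4 * (?h x)\<^sup>2" by simp
    moreover have "\<alpha> * ?h x \<le> 1 + \<alpha>\<^sup>2 / 4 * (?h x)\<^sup>2"
      using sum_squares_bound[of 1 "\<alpha> * ?h x / 2"] by (simp add: power_mult_distrib power_divide)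
    ultimately show ?thesis by linarith
  qed
  have AZ: "A \<subseteq> Z" using A by (simp add: sidon_def)
  have "sqrt (real N) * (\<alpha> * sqrt (real N)) \<le> (\<Sum>x\<in>Z. ?h x)"
    unfolding sum_smooth[OF AZ B(1,2)] by (intro mult_left_mono \<alpha>) simp
  then have "\<alpha> * (\<alpha> * real N) \<le> \<alpha> * (\<Sum>x\<in>Z. ?h x)"
    using \<alpha> by (intro mult_left_mono) (simp_all add: mult.left_commute)
  moreover have "\<alpha>\<^sup>2 / 4 * (\<Sum>x\<in>Z. (?h x)\<^sup>2) \<le> \<alpha>\<^sup>2 / 4 * (2 * real N)"
    by (intro mult_left_mono smooth_energy A B) simp
  moreover have "(\<Sum>x\<in>Z. \<alpha> * ?h x - \<alpha>\<^sup>2 / 4 * (?h x)\<^sup>2) \<le> (\<Sum>x\<in>Z. min (?h x) 1)"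
    by (intro sum_mono pt)
  moreover have "(\<Sum>x\<in>Z. \<alpha> * ?h x - \<alpha>\<^sup>2 / 4 * (?h x)\<^sup>2) =
      \<alpha> * (\<Sum>x\<in>Z. ?h x) - \<alpha>\<^sup>2 / 4 * (\<Sum>x\<in>Z. (?h x)\<^sup>2)"
    by (simp only: sum_subtractf sum_distrib_left)
  moreover have "\<alpha> * (\<alpha> * real N) = \<alpha>\<^sup>2 / 2 * real N + \<alpha>\<^sup>2 / 4 * (2 * real N)"
    by (simp add: power2_eq_square)
  ultimately show ?thesis by linarith
qed

text \<open>The thresholds have separate tasks: \<open>\<eta>0\<close> defines the translations
  \<open>D\<close>, \<open>\<eta>1\<close> the averaging set \<open>B\<close>, and
  \<open>\<eta>2\<close> the cutoff beyond which frequencies are negligible for the average.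
  Invariance under \<open>D\<close> yields many solutions for the average, and these are transferred
  back to \<open>A\<close>.\<close>

lemma sol_sum_at_good_scale:
  assumes A: "sidon A" and cop: "coprime 2 (int N)" "coprime 3 (int N)"
    and \<alpha>: "0 < \<alpha>" "\<alpha> \<le> 1" "\<alpha> * sqrt (real N) \<le> real (card A)"
    and m: "m = \<alpha>\<^sup>2 / 2" and \<delta>: "\<delta> = m ^ 3 / 10"
    and \<mu>: "\<mu>0 = bohr_density \<eta>0" "\<mu>1 = bohr_density \<eta>1"
    and \<eta>: "0 < \<eta>0" "\<eta>0 \<le> \<delta> / 6" "0 < \<eta>1" "\<eta>1 \<le> \<mu>0\<^sup>2 * m ^ 5 / 320"
      "0 < \<eta>2" "\<eta>2 \<le> \<eta>0" "\<eta>2 \<le> \<delta> * \<mu>1 / 4"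
    and large: "real (card A) \<le> \<mu>0 * real N" "real (card A) \<le> \<mu>1 * real N"
    and mass: "(\<Sum>r\<in>spec A \<eta>2 - spec A \<eta>0. (cmod (dft (ind A) r))\<^sup>2) \<le> \<delta>\<^sup>2 / 16 * real N"
  shows "\<mu>0\<^sup>2 * m ^ 5 / 8 * real N ^ 4 \<le> real N ^ 2 * sqrt (real N) * sol_sum (ind A)"
proof -
  define D where "D = bohr A \<eta>0"
  define B where "B = bohr A \<eta>1"
  let ?h = "smooth A B"
  have N0: "real N > 0" using N_pos by simp
  have \<mu>0: "0 < \<mu>0" "\<mu>0 \<le> 1" and \<mu>1: "0 < \<mu>1" "\<mu>1 \<le> 1"
    using bohr_density_bounds by (auto simp: \<mu>)
  have D: "\<mu>0 * real N \<le> real (card D)" "D \<subseteq> Z"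
    using card_bohr[OF A \<eta>(1)] bohr_subset by (auto simp: D_def \<mu>)
  have B: "\<mu>1 * real N \<le> real (card B)" "B \<subseteq> Z"
    using card_bohr[OF A \<eta>(3)] bohr_subset by (auto simp: B_def \<mu>)
  have "0 < real (card B)" using B(1) \<mu>1 N0 by (meson less_le_trans mult_pos_pos)
  then have Bne: "B \<noteq> {}" by auto
  have cD: "card A \<le> card D" and cB: "card A \<le> card B" using D(1) B(1) large by linarith+
  have m0: "0 < m" "m \<le> 1"
    using \<alpha> power_le_one[of \<alpha> 2] by (auto simp: m)
  have m32: "m ^ 3 \<le> m\<^sup>2" "m ^ 3 \<le> 1"
    using m0 by (auto intro: power_decreasing power_le_one)
  have \<delta>0: "0 < \<delta>" "\<delta> \<le> 1 / 10" using m0 m32 by (auto simp: \<delta>)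
  \<comment> \<open>The three terms are at most 2/9, 1/4 and 1/4 of
    \<open>\<delta>\<^sup>2\<close>.\<close>
  have small: "8 * \<eta>0\<^sup>2 + 4 * (\<delta>\<^sup>2 / 16) + 4 * \<eta>2\<^sup>2 / \<mu>1 \<le> \<delta>\<^sup>2"
  proof -
    have "\<eta>0\<^sup>2 \<le> (\<delta> / 6)\<^sup>2" using \<eta> by (intro power_mono) auto
    moreover have "\<eta>2\<^sup>2 / \<mu>1 \<le> \<delta>\<^sup>2 / 16"
    proof -
      have "\<eta>2\<^sup>2 \<le> (\<delta> * \<mu>1 / 4)\<^sup>2" using \<eta> by (intro power_mono) auto
      also have "\<dots> = \<delta>\<^sup>2 / 16 * (\<mu>1 * \<mu>1)" by (simp add: power2_eq_square)
      also have "\<dots> \<le> \<delta>\<^sup>2 / 16 * (1 * \<mu>1)" using \<mu>1 by (intro mult_left_mono mult_right_mono) auto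
      finally show ?thesis using \<mu>1 by (simp add: divide_le_eq)
    qed
    moreover have "4 * \<eta>2\<^sup>2 / \<mu>1 = 4 * (\<eta>2\<^sup>2 / \<mu>1)" by simp
    moreover have "(\<delta> / 6)\<^sup>2 = \<delta>\<^sup>2 / 36" by (simp add: power_divide)
    moreover have "0 \<le> \<delta>\<^sup>2" by simp
    ultimately show ?thesis by linarith
  qed
  have inv: "(\<Sum>x\<in>Z. \<bar>?h (x + b) - ?h x\<bar>) \<le> \<delta> * real N" if "b \<in> D" for b
    using \<eta> \<delta>0 cD that B(1) \<mu>1
    by (intro smooth_almost_invariant[OF A _ _ _ _ _ B(2) Bne _ _ mass small]) (auto simp: D_def)
  have "\<mu>0\<^sup>2 * m ^ 5 / 4 * real N ^ 4 = (\<mu>0 * real N)\<^sup>2 * (m\<^sup>2 / 2 * real N * (m ^ 3 / 2 * real N))"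
    by (simp add: power_mult_distrib eval_nat_numeral)
  \<comment> \<open>Here \<open>5 * \<delta>\<close> is half of \<open>m ^ 3\<close> and
    \<open>m \<le> 1\<close>, so at least half of each power of \<open>m\<close> remains.\<close>
  also have "\<dots> \<le> (real (card D))\<^sup>2 * ((m\<^sup>2 - 5 * \<delta>) * real N * ((m ^ 3 - 2 * \<delta>) * real N))"
  proof (intro mult_mono power_mono D(1))
    have "0 \<le> m\<^sup>2" "0 \<le> m ^ 3" using m0 by auto
    then show "m\<^sup>2 / 2 \<le> m\<^sup>2 - 5 * \<delta>" "m ^ 3 / 2 \<le> m ^ 3 - 2 * \<delta>" "0 \<le> m\<^sup>2 - 5 * \<delta>"
      using m32(1) unfolding \<delta> by linarith+
    then show "0 \<le> (m\<^sup>2 - 5 * \<delta>) * real N" by simp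
  qed (use \<mu>0 m0 in \<open>auto simp: \<delta>\<close>)
  also have "\<dots> \<le> sol_sum ?h"
  proof (intro sol_sum_lower_bound periodic_smooth smooth_nonneg D inv)
    show "m * real N \<le> (\<Sum>x\<in>Z. min (?h x) 1)"
      unfolding m using \<alpha> by (intro sum_min_smooth A B Bne cB) auto
    have "0 \<le> m ^ 3" "0 \<le> m\<^sup>2" using m0 by auto
    then show "5 * \<delta> \<le> m\<^sup>2" "2 * \<delta> \<le> m ^ 3" using m32(1) unfolding \<delta> by linarith+
  qed (use m0 in auto)
  finally have lower: "\<mu>0\<^sup>2 * m ^ 5 / 4 * real N ^ 4 \<le> sol_sum ?h" .
  \<comment> \<open>On the spectrum the factors are at most \<open>2 * sqrt N\<close> and
    \<open>\<eta>1\<close>, off it at most \<open>\<eta>1 * sqrt N\<close> and 2. The frequency is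
    reduced first because \<open>spec\<close> contains only representatives in
    \<open>Z\<close>.\<close>
  have "cmod (dft (ind A) r) * cmod (1 - bhat B r) \<le> 2 * \<eta>1 * sqrt (real N)" for r
  proof -
    define r' where "r' = r mod int N"
    have eq: "dft (ind A) r = dft (ind A) r'" "bhat B r = bhat B r'"
      unfolding bhat_def r'_def using periodic_dft by (simp_all add: periodic_def)
    show ?thesis
    proof (cases "r' \<in> spec A \<eta>1")
      case True
      have "cmod (dft (ind A) r') \<le> real (card A)"
        using A by (intro norm_dft_ind) (simp add: sidon_def)
      also have "\<dots> \<le> 2 * sqrt (real N)"
      proof (rule power2_le_imp_le)
        show "(real (card A))\<^sup>2 \<le> (2 * sqrt (real N))\<^sup>2"
          using sidon_card_square[OF A] by (simp add: power_mult_distrib)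
      qed simp
      finally have "cmod (dft (ind A) r') * cmod (1 - bhat B r') \<le> 2 * sqrt (real N) * \<eta>1"
        using bhat_bohr[OF True] Bne
        by (intro mult_mono) (auto simp: B_def norm_minus_commute)
      then show ?thesis by (simp add: eq mult_ac)
    next
      case False
      then have "cmod (dft (ind A) r') \<le> \<eta>1 * sqrt (real N)"
        by (auto simp: spec_def r'_def)
      moreover have "cmod (1 - bhat B r') \<le> 2"
        using norm_triangle_ineq4[of 1 "bhat B r'"] norm_bhat[OF B(2), of r'] by simp
      ultimately have "cmod (dft (ind A) r') * cmod (1 - bhat B r') \<le> \<eta>1 * sqrt (real N) * 2"
        using \<eta> by (intro mult_mono) auto
      then show ?thesis by (simp add: eq mult_ac)
    qed
  qed
  from sol_sum_smooth_approx[OF A B(2) cop this]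
  have "\<bar>real N ^ 2 * sqrt (real N) * sol_sum (ind A) - sol_sum ?h\<bar> \<le>
      40 * \<eta>1 * (real N ^ 3 * (sqrt (real N) * sqrt (real N)))"
    by (simp only: mult_ac)
  also have "real N ^ 3 * (sqrt (real N) * sqrt (real N)) = real N ^ 4"
    by (simp add: eval_nat_numeral)
  finally have "\<bar>real N ^ 2 * sqrt (real N) * sol_sum (ind A) - sol_sum ?h\<bar> \<le> 40 * \<eta>1 * real N ^ 4" .
  \<comment> \<open>By the choice of \<open>\<eta>1\<close> the error is at most half of the main
    term in \<open>lower\<close>.\<close>
  moreover have "40 * \<eta>1 * real N ^ 4 \<le> 40 * (\<mu>0\<^sup>2 * m ^ 5 / 320) * real N ^ 4"
    using \<eta> by (intro mult_right_mono mult_left_mono) auto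
  ultimately show ?thesis using lower by simp
qed

text \<open>With \<open>N = 6 * n + 1\<close> the linear form and its residue in
  \<open>{1..n}\<close> differ by less than \<open>N\<close>, so a solution modulo \<open>N\<close>
  is a solution in the integers. It is then trivial, and each of the two trivial families is
  parametrised by a pair from \<open>A\<close>.\<close>

lemma sol_sum_ind_le:
  assumes A: "A \<subseteq> {1..int n}" and N: "N = 6 * n + 1" and sol: "no_nontrivial_sol A"
  shows "sol_sum (ind A) \<le> 2 * (real (card A))\<^sup>2"
proof -
  have AZ: "A \<subseteq> Z" unfolding Z_def using A N by auto
  have fin: "finite A" using A finite_subset by blast
  define T where "T = {(x1, x2, x3, x5). x1 \<in> A \<and> x2 \<in> A \<and> x3 \<in> A \<and> x5 \<in> A \<and>
      (x1 + x2 + 2 * x3 - 3 * x5) mod int N \<in> A}"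
  define F where "F = (\<lambda>(x1, x2, x3, x5). ind A (x1 + x2 + 2 * x3 - 3 * x5))"
  have Tsub: "T \<subseteq> A \<times> A \<times> A \<times> A" by (auto simp: T_def)
  have "sol_sum (ind A) = (\<Sum>x1\<in>A. \<Sum>x2\<in>A. \<Sum>x3\<in>A. \<Sum>x5\<in>A. ind A (x1 + x2 + 2 * x3 - 3 * x5))"
    unfolding sol_sum_def
    by (simp only: mult.assoc sum_distrib_left[symmetric] sum_ind_mult[OF AZ])
  also have "\<dots> = (\<Sum>p\<in>A \<times> A \<times> A \<times> A. F p)"
    by (simp only: sum.cartesian_product F_def)
  also have "\<dots> = (\<Sum>p\<in>T. F p)"
  proof (intro sum.mono_neutral_right Tsub ballI)
    fix p assume p: "p \<in> A \<times> A \<times> A \<times> A - T"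
    obtain x1 x2 x3 x5 where e: "p = (x1, x2, x3, x5)" by (cases p)
    then have "(x1 + x2 + 2 * x3 - 3 * x5) mod int N \<notin> A" using p unfolding T_def by blast
    then show "F p = 0" by (simp only: F_def e prod.case ind_def if_False)
  qed (use fin in simp)
  also have "\<dots> = (\<Sum>p\<in>T. 1)"
    by (intro sum.cong refl) (auto simp: F_def T_def ind_def)
  also have "\<dots> = real (card T)" by simp
  also have "card T \<le> card ((\<lambda>(x, y). (x, y, y, y)) ` (A \<times> A) \<union> (\<lambda>(x, y). (y, x, y, y)) ` (A \<times> A))"
  proof (intro card_mono)
    show "T \<subseteq> (\<lambda>(x, y). (x, y, y, y)) ` (A \<times> A) \<union> (\<lambda>(x, y). (y, x, y, y)) ` (A \<times> A)"
    proof
      fix p assume "p \<in> T"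
      then obtain x1 x2 x3 x5 where p: "p = (x1, x2, x3, x5)"
        and x: "x1 \<in> A" "x2 \<in> A" "x3 \<in> A" "x5 \<in> A"
        and x4: "(x1 + x2 + 2 * x3 - 3 * x5) mod int N \<in> A" by (auto simp: T_def)
      define v where "v = x1 + x2 + 2 * x3 - 3 * x5"
      have bds: "1 \<le> x1" "x1 \<le> int n" "1 \<le> x2" "x2 \<le> int n" "1 \<le> x3" "x3 \<le> int n"
        "1 \<le> x5" "x5 \<le> int n" "1 \<le> v mod int N" "v mod int N \<le> int n"
        using x x4 A by (auto simp: v_def)
      have "int N dvd v - v mod int N" by (simp add: mod_eq_dvd_iff[symmetric])
      moreover have "\<bar>v - v mod int N\<bar> < int N" using bds N by (simp add: v_def abs_if)
      ultimately have "v mod int N = v"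
        using dvd_imp_le_int[of "v - v mod int N" "int N"] by force
      then have "v \<in> A" using x4 by (simp add: v_def)
      moreover have "x1 + x2 + 2 * x3 = v + 3 * x5" by (simp add: v_def)
      ultimately have "trivial_sol x1 x2 x3 v x5"
        using sol x unfolding no_nontrivial_sol_def by blast
      then show "p \<in> (\<lambda>(x, y). (x, y, y, y)) ` (A \<times> A) \<union> (\<lambda>(x, y). (y, x, y, y)) ` (A \<times> A)"
        using x by (auto simp: trivial_sol_def p)
    qed
  qed (use fin in auto)
  also have "\<dots> \<le> card ((\<lambda>(x, y). (x, y, y, y)) ` (A \<times> A)) + card ((\<lambda>(x, y). (y, x, y, y)) ` (A \<times> A))"
    by (rule card_Un_le)
  also have "\<dots> \<le> card (A \<times> A) + card (A \<times> A)"
    using fin by (intro add_mono card_image_le) auto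
  finally show ?thesis by (simp add: card_cartesian_product power2_eq_square)
qed

text \<open>Solutions with \<open>x3 = x5\<close> are solutions of the Sidon equation.\<close>

lemma no_nontrivial_sol_sidon:
  assumes A: "A \<subseteq> {1..int n}" and N: "N = 6 * n + 1" and sol: "no_nontrivial_sol A"
  shows "sidon A"
  unfolding sidon_def
proof (intro conjI ballI impI)
  show "A \<subseteq> Z" unfolding Z_def using A N by auto
  fix a b c d assume x: "a \<in> A" "b \<in> A" "c \<in> A" "d \<in> A" and dvd: "int N dvd (a + b) - (c + d)"
  have "1 \<le> a" "a \<le> int n" "1 \<le> b" "b \<le> int n" "1 \<le> c" "c \<le> int n" "1 \<le> d" "d \<le> int n"
    using x A by auto
  then have "\<bar>(a + b) - (c + d)\<bar> < int N" using N by (simp add: abs_if)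
  then have "a + b = c + d"
    using dvd dvd_imp_le_int[of "(a + b) - (c + d)" "int N"] by force
  then have "trivial_sol a b d c d"
    using sol x unfolding no_nontrivial_sol_def by simp
  then show "a = c \<and> b = d \<or> a = d \<and> b = c" by (auto simp: trivial_sol_def)
qed

end

section \<open>The sequence of thresholds and the conclusion\<close>

primrec scale :: "real \<Rightarrow> nat \<Rightarrow> real" where
  "scale m 0 = m ^ 3 / 60"
| "scale m (Suc i) = min (scale m i) (min ((bohr_density (scale m i))\<^sup>2 * m ^ 5 / 320)
     (m ^ 3 / 10 * bohr_density (scale m i) / 4))"

text \<open>Whichever step turns out to be good, a threshold must be able to follow its predecessor
  both as \<open>\<eta>1\<close> (first bound) and as \<open>\<eta>2\<close> (second bound) in
  \<open>sol_sum_at_good_scale\<close>. With \<open>\<delta> = m ^ 3 / 10\<close> the initial value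
  \<open>m ^ 3 / 60\<close> is \<open>\<delta> / 6\<close>. The sequence depends on \<open>m\<close>
  alone, not on \<open>N\<close>.\<close>

lemma scale_Suc_le:
  "scale m (Suc i) \<le> (bohr_density (scale m i))\<^sup>2 * m ^ 5 / 320"
  "scale m (Suc i) \<le> m ^ 3 / 10 * bohr_density (scale m i) / 4"
  by simp_all

lemma scale_pos: "m > 0 \<Longrightarrow> scale m i > 0"
  by (induction i)
    (auto intro!: mult_pos_pos divide_pos_pos zero_less_power bohr_density_bounds)

lemma scale_antimono: "i \<le> j \<Longrightarrow> scale m j \<le> scale m i"
  by (rule lift_Suc_antimono_le) simp_all

theorem theorem1p13:
  fixes \<epsilon> :: real
  assumes "\<epsilon> > 0"
  shows "\<exists>n0::nat. \<forall>n\<ge>n0. \<forall>A. A \<subseteq> {1..int n} \<longrightarrow> no_nontrivial_sol A \<longrightarrow>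
           real (card A) \<le> \<epsilon> * sqrt (real n)"
proof -
  \<comment> \<open>The 3 compensates for \<open>sqrt N \<le> 3 * sqrt n\<close>, which holds since
    \<open>6 * n + 1 \<le> 9 * n\<close>.\<close>
  define \<alpha> where "\<alpha> = min 1 (\<epsilon> / 3)"
  have \<alpha>: "0 < \<alpha>" "\<alpha> \<le> 1" "3 * \<alpha> \<le> \<epsilon>" using assms by (auto simp: \<alpha>_def)
  define m where "m = \<alpha>\<^sup>2 / 2"
  have m0: "0 < m" "m \<le> 1" using \<alpha> power_le_one[of \<alpha> 2] by (auto simp: m_def)
  define \<delta> where "\<delta> = m ^ 3 / 10"
  have \<delta>0: "0 < \<delta>" using m0 by (simp add: \<delta>_def)
  \<comment> \<open>Large enough for \<open>pigeonhole_gap\<close> with the mass bound 8 from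
    \<open>spec_mass\<close> and the gap \<open>\<delta>\<^sup>2 / 16\<close>.\<close>
  define K where "K = nat \<lceil>16 / (\<delta>\<^sup>2 / 16)\<rceil> + 1"
  have "16 / (\<delta>\<^sup>2 / 16) < real K" unfolding K_def by linarith
  then have K: "2 * 8 < \<delta>\<^sup>2 / 16 * real K" using \<delta>0 by (simp add: field_simps)
  define \<mu> where "\<mu> i = bohr_density (scale m i)" for i
  have \<mu>: "0 < \<mu> i" "\<mu> i \<le> 1" for i using bohr_density_bounds by (auto simp: \<mu>_def)
  \<comment> \<open>If scale \<open>i\<close> is good, the two bounds for the solution count force
    \<open>sqrt N \<le> C i\<close>. Moreover \<open>C i\<close> is at least
    \<open>2 / \<mu> i\<close>, so a larger \<open>sqrt N\<close> makes the Bohr sets at least as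
    large as \<open>A\<close>.\<close>
  define C where "C i = 32 / ((\<mu> i)\<^sup>2 * m ^ 5)" for i
  \<comment> \<open>The good scale depends on \<open>n\<close> and \<open>A\<close>, so
    \<open>n0\<close> has to dominate the squares of \<open>C i\<close> at all scales at
    once.\<close>
  define n0 where "n0 = nat \<lceil>\<Sum>i\<le>Suc K. (C i)\<^sup>2\<rceil> + 1"
  show ?thesis
  proof (intro exI[of _ n0] allI impI, rule ccontr)
    fix n A
    assume n: "n0 \<le> n" and A: "A \<subseteq> {1..int n}" and sol: "no_nontrivial_sol A"
      and "\<not> real (card A) \<le> \<epsilon> * sqrt (real n)"
    then have dense: "\<epsilon> * sqrt (real n) < real (card A)" by simp
    define N where "N = 6 * n + 1"
    interpret residue_fourier N by unfold_locales (simp add: N_def)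
    have n1: "n \<ge> 1" using n by (simp add: n0_def)
    have sid: "sidon A" by (rule no_nontrivial_sol_sidon[OF A N_def sol])
    have N0: "0 < sqrt (real N)" by (simp add: N_def)
    have "sqrt (real N) \<le> sqrt (9 * real n)" using n1 by (simp add: N_def)
    also have "\<dots> = 3 * sqrt (real n)" by (simp add: real_sqrt_mult)
    finally have "\<alpha> * sqrt (real N) \<le> \<alpha> * (3 * sqrt (real n))" using \<alpha> by (intro mult_left_mono) auto
    also have "\<dots> \<le> \<epsilon> * sqrt (real n)" using \<alpha> mult_right_mono[of "3 * \<alpha>" \<epsilon> "sqrt (real n)"] by simp
    finally have cA: "\<alpha> * sqrt (real N) \<le> real (card A)" using dense by simp
    have big: "C i < sqrt (real N)" if "i \<le> Suc K" for i
    proof (rule real_less_rsqrt)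
      have "(C i)\<^sup>2 \<le> (\<Sum>i\<le>Suc K. (C i)\<^sup>2)" using that by (intro member_le_sum) auto
      also have "\<dots> < real n0" unfolding n0_def by linarith
      also have "\<dots> \<le> real N" using n by (simp add: N_def)
      finally show "(C i)\<^sup>2 < real N" .
    qed
    have cA2: "real (card A) \<le> 2 * sqrt (real N)"
    proof (rule power2_le_imp_le)
      show "(real (card A))\<^sup>2 \<le> (2 * sqrt (real N))\<^sup>2"
        using sidon_card_square[OF sid] by (simp add: power_mult_distrib)
    qed simp
    have large: "real (card A) \<le> \<mu> i * real N" if "i \<le> Suc K" for i
    proof -
      have "2 \<le> \<mu> i * C i"
      proof -
        have "\<mu> i * m ^ 5 \<le> 1 * 1" using \<mu>[of i] m0 by (intro mult_mono power_le_one) auto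
        then have "2 * (\<mu> i * m ^ 5) \<le> 32" by simp
        then show ?thesis using \<mu>(1)[of i] m0 by (simp add: C_def field_simps power2_eq_square)
      qed
      also have "\<dots> \<le> \<mu> i * sqrt (real N)" using \<mu>[of i] big[OF that] by simp
      finally have "2 * sqrt (real N) \<le> \<mu> i * sqrt (real N) * sqrt (real N)"
        by (intro mult_right_mono) auto
      then show ?thesis using cA2 by (simp add: mult.assoc)
    qed
    have scale0: "scale m i \<le> \<delta> / 6" for i
      using scale_antimono[of 0 i m] by (simp add: \<delta>_def)
    have "m ^ 3 \<le> 1" using m0 by (simp add: power_le_one)
    then have scale_half: "scale m i \<le> 1 / 2" for i
      using scale0[of i] by (simp add: \<delta>_def)
    define f where "f i = (\<Sum>r\<in>spec A (scale m i). (cmod (dft (ind A) r))\<^sup>2) / real N" for i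
    have "0 \<le> f i \<and> f i \<le> 8" if "i \<le> Suc K" for i
    proof -
      have pos: "scale m i > 0" by (rule scale_pos[OF m0(1)])
      have le: "\<mu> i * real N \<le> real (card (bohr A (scale m i)))"
        unfolding \<mu>_def by (rule card_bohr[OF sid pos])
      have "0 < \<mu> i * real N" using \<mu> N_pos by simp
      then have "bohr A (scale m i) \<noteq> {}" using le by auto
      then have "(\<Sum>r\<in>spec A (scale m i). (cmod (dft (ind A) r))\<^sup>2) \<le> 8 * real N"
        using le large[OF that] by (intro spec_mass sid scale_half) auto
      then show ?thesis using N_pos by (simp add: f_def divide_le_eq sum_nonneg)
    qed
    from pigeonhole_gap[of K f, OF this K] obtain i where i: "i < K" "f (i + 2) - f i \<le> \<delta>\<^sup>2 / 16"
      by blast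
    have mass: "(\<Sum>r\<in>spec A (scale m (i + 2)) - spec A (scale m i). (cmod (dft (ind A) r))\<^sup>2) \<le>
        \<delta>\<^sup>2 / 16 * real N"
    proof -
      have "spec A (scale m i) \<subseteq> spec A (scale m (i + 2))"
        by (intro spec_antimono scale_antimono) simp
      then have "(\<Sum>r\<in>spec A (scale m (i + 2)) - spec A (scale m i). (cmod (dft (ind A) r))\<^sup>2) =
        (f (i + 2) - f i) * real N"
        using N_pos by (simp add: sum_diff[OF finite_spec] f_def left_diff_distrib)
      also have "\<dots> \<le> \<delta>\<^sup>2 / 16 * real N" using i by (intro mult_right_mono) auto
      finally show ?thesis .
    qed
    \<comment> \<open>As \<open>N\<close> is 1 modulo 6, the coefficients 2 and 3 of the equation
      are invertible.\<close>
    have "coprime k (int N)" if k: "k dvd 6" for k :: int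
    proof (rule coprimeI)
      fix c assume c: "c dvd k" "c dvd int N"
      have "c dvd 6 * int n" using c(1) k by (meson dvd_mult2 dvd_trans)
      with c(2) have "c dvd int N - 6 * int n" by (rule dvd_diff)
      then show "is_unit c" by (simp add: N_def)
    qed
    from this[of 2] this[of 3] have cop: "coprime 2 (int N)" "coprime 3 (int N)" by simp_all
    \<comment> \<open>The thresholds \<open>scale m i\<close>, \<open>scale m (Suc i)\<close> and
      \<open>scale m (i + 2)\<close> are used as \<open>\<eta>0\<close>, \<open>\<eta>1\<close> and
      \<open>\<eta>2\<close>.\<close>
    have "(\<mu> i)\<^sup>2 * m ^ 5 / 8 * real N ^ 4 \<le> real N ^ 2 * sqrt (real N) * sol_sum (ind A)"
    proof (rule sol_sum_at_good_scale[OF sid cop \<alpha>(1,2) cA m_def \<delta>_def \<mu>_def \<mu>_def])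
      show "scale m (Suc i) \<le> (\<mu> i)\<^sup>2 * m ^ 5 / 320" unfolding \<mu>_def by (rule scale_Suc_le)
      show "scale m (i + 2) \<le> \<delta> * \<mu> (Suc i) / 4"
        using scale_Suc_le(2)[of m "Suc i"] unfolding \<mu>_def \<delta>_def by (simp only: add_2_eq_Suc')
      show "scale m (i + 2) \<le> scale m i" by (intro scale_antimono) simp
    qed (use i in \<open>simp_all only: scale_pos[OF m0(1)] scale0 large mass\<close>)
    also have "\<dots> \<le> real N ^ 2 * sqrt (real N) * (2 * (2 * real N))"
      using sol_sum_ind_le[OF A N_def sol] sidon_card_square[OF sid]
      by (intro mult_left_mono) auto
    also have "\<dots> = real N ^ 3 * sqrt (real N) * 4"
      by (simp add: eval_nat_numeral)
    \<comment> \<open>After cancelling \<open>N ^ 3 * sqrt N\<close>, one factor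
      \<open>sqrt N\<close> is left against a constant.\<close>
    also have "real N ^ 4 = real N ^ 3 * sqrt (real N) * sqrt (real N)"
      by (simp add: eval_nat_numeral)
    finally have "real N ^ 3 * sqrt (real N) * ((\<mu> i)\<^sup>2 * m ^ 5 * sqrt (real N)) \<le>
        real N ^ 3 * sqrt (real N) * 32"
      by (simp add: mult_ac)
    then have "(\<mu> i)\<^sup>2 * m ^ 5 * sqrt (real N) \<le> 32"
      using N0 by (simp add: N_def)
    then have "sqrt (real N) \<le> C i"
      using \<mu>(1)[of i] m0 by (simp add: C_def field_simps)
    then show False using big[of i] i by simp
  qed
qed

end
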